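(* Let $X$ be a Banach space over the field $\mathbb F$ of real or complex numbers and let $\mathcal A$ be a standard operator subalgebra of $\mathcal B(X)$ containing the identity $I$. Let $\xi\in\mathbb F$ with $\xi\ne0$ and let $\delta:\mathcal A\to\mathcal B(X)$ be an additive generalized $\xi$-Lie derivation. (1) If $\xi=1$ and $\dim X\ge3$, then there exist an additive generalized derivation $\tau:\mathcal A\to\mathcal B(X)$ and an additive map $h:\mathcal A\to\mathbb F$ with $h([A,B])=0$ for all $A,B\in\mathcal A$, such that $\delta(A)=\tau(A)+h(A)I$ for all $A\in\mathcal A$. (2) If $\xi\ne1$, then $\delta$ is an additive generalized derivation and $\delta(\xi A)=\xi\delta(A)$ for all $A\in\mathcal A$.
   Context: $\mathcal B(X)$ is the Banach algebra of all bounded linear operators on $X$. A subalgebra $\mathcal A\subseteq\mathcal B(X)$ is a standard operator algebra if it contains all finite rank operators of $\mathcal B(X)$; it is not required to be norm closed. For $\xi\in\mathbb F$, $[A,B]_\xi=AB-\xi BA$ and $[A,B]=AB-BA$. An additive map $L:\mathcal A\to\mathcal B(X)$ is an additive $\xi$-Lie derivation if $L([A,B]_\xi)=[L(A),B]_\xi+[A,L(B)]_\xi$ for all $A,B\in\mathcal A$. An additive map $\delta:\mathcal A\to\mathcal B(X)$ is an additive generalized $\xi$-Lie derivation if there exists an additive $\xi$-Lie derivation $L:\mathcal A\to\mathcal B(X)$ such that $$\delta([A,B]_\xi)=\delta(A)B-\xi\delta(B)A+AL(B)-\xi BL(A)\quad\text{for all }A,B\in\mathcal A.$$ An additive map $d:\mathcal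 A\to\mathcal B(X)$ is an additive derivation if $d(AB)=d(A)B+Ad(B)$ for all $A,B\in\mathcal A$; an additive map $\tau:\mathcal A\to\mathcal B(X)$ is an additive generalized derivation if there is an additive derivation $d:\mathcal A\to\mathcal B(X)$ with $\tau(AB)=\tau(A)B+Ad(B)$ for all $A,B\in\mathcal A$. (Additive maps are not assumed linear.)
   Formalization: In (2), δ(ξA)=ξδ(A) is asserted only when dim X ≠ 1: it fails for X=F, ξ transcendental, δ(a)=D(a)+ta with D an additive derivation of F, D(ξ)≠0, t=D(1−ξ)/(1−ξ). That δ is an additive generalized derivation is proved in every dimension. *)

theory Defs
  imports "HOL-Analysis.Analysis"
begin

(* The normed fields isomorphic to the reals or to the complex numbers. The norm needs no further
   axiom: a multiplicative norm extending the absolute value of the reals is unique on both. *)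
class real_or_complex = real_normed_field +
  assumes real_or_complex:
    "(\<forall>z. \<exists>a. z = a *\<^sub>R 1) \<or> (\<exists>i. i * i = - 1 \<and> (\<forall>z. \<exists>a b. z = a *\<^sub>R 1 + b *\<^sub>R i))"

instance real :: real_or_complex
  by standard simp

instance complex :: real_or_complex
proof
  have "z = Re z *\<^sub>R 1 + Im z *\<^sub>R \<i>" for z
    by (simp add: complex_eq_iff)
  then have "\<i> * \<i> = - 1 \<and> (\<forall>z. \<exists>a b. z = a *\<^sub>R 1 + b *\<^sub>R \<i>)"
    by (metis i_squared)
  then show "(\<forall>z::complex. \<exists>a. z = a *\<^sub>R 1) \<or>
      (\<exists>i::complex. i * i = - 1 \<and> (\<forall>z. \<exists>a b. z = a *\<^sub>R 1 + b *\<^sub>R i))"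
    by blast
qed

(* A Banach space over 'f whose points form the type 'x. The library class banach supplies the norm,
   completeness and the multiplication by real scalars, which smul extends to 'f. *)
locale banach_space_over = vector_space smul
  for smul :: "'f::real_or_complex \<Rightarrow> 'x::banach \<Rightarrow> 'x" +
  assumes scale_of_real: "smul (of_real r) x = r *\<^sub>R x"
    and norm_scale: "norm (smul c x) = norm c * norm x"

lemma banach_space_over_real: "banach_space_over (scaleR :: real \<Rightarrow> 'x::banach \<Rightarrow> 'x)"
  by unfold_locales (simp_all add: algebra_simps)

lemma banach_space_over_complex: "banach_space_over ((*) :: complex \<Rightarrow> complex \<Rightarrow> complex)"
  by unfold_locales (simp_all add: algebra_simps norm_mult scaleR_conv_of_real)

(* Includes the infinite-dimensional case, in which the library's dim is 0. *)
definition dim_at_least :: "('f::field \<Rightarrow> 'x::ab_group_add \<Rightarrow> 'x) \<Rightarrow> nat \<Rightarrow> bool" where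
  "dim_at_least smul n \<longleftrightarrow> (\<exists>S. finite S \<and> card S = n \<and> \<not> module.dependent smul S)"

(* The type of bounded operators of the library only knows real linearity. *)
definition bounded_operators ::
  "('f::real_or_complex \<Rightarrow> 'x::banach \<Rightarrow> 'x) \<Rightarrow> ('x \<Rightarrow>\<^sub>L 'x) set" where
  "bounded_operators smul = {T. \<forall>c x. blinfun_apply T (smul c x) = smul c (blinfun_apply T x)}"

definition op_scale ::
  "('f::real_or_complex \<Rightarrow> 'x::banach \<Rightarrow> 'x) \<Rightarrow> 'f \<Rightarrow> ('x \<Rightarrow>\<^sub>L 'x) \<Rightarrow> ('x \<Rightarrow>\<^sub>L 'x)" where
  "op_scale smul c T = Blinfun (\<lambda>x. smul c (blinfun_apply T x))"

lemma (in banach_space_over) bounded_linear_scale: "bounded_linear (smul c)"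
proof
  show "smul c (x + y) = smul c x + smul c y" for x y
    by (simp add: scale_right_distrib)
  show "smul c (r *\<^sub>R x) = r *\<^sub>R smul c x" for r x
    by (metis scale_of_real scale_left_commute)
  show "\<exists>K. \<forall>x. norm (smul c x) \<le> norm x * K"
    by (rule exI[of _ "norm c"]) (simp add: norm_scale mult.commute)
qed

lemma (in banach_space_over) op_scale_apply:
  "blinfun_apply (op_scale smul c T) x = smul c (blinfun_apply T x)"
  unfolding op_scale_def
  by (simp add: bounded_linear_Blinfun_apply
      bounded_linear_compose[OF bounded_linear_scale blinfun.bounded_linear_right])

definition finite_rank ::
  "('f::real_or_complex \<Rightarrow> 'x::banach \<Rightarrow> 'x) \<Rightarrow> ('x \<Rightarrow>\<^sub>L 'x) \<Rightarrow> bool" where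
  "finite_rank smul T \<longleftrightarrow> (\<exists>S. finite S \<and> range (blinfun_apply T) \<subseteq> module.span smul S)"

definition operator_subalgebra ::
  "('f::real_or_complex \<Rightarrow> 'x::banach \<Rightarrow> 'x) \<Rightarrow> ('x \<Rightarrow>\<^sub>L 'x) set \<Rightarrow> bool" where
  "operator_subalgebra smul \<A> \<longleftrightarrow>
    \<A> \<subseteq> bounded_operators smul \<and> 0 \<in> \<A> \<and>
    (\<forall>A\<in>\<A>. \<forall>B\<in>\<A>. A + B \<in> \<A>) \<and>
    (\<forall>c. \<forall>A\<in>\<A>. op_scale smul c A \<in> \<A>) \<and>
    (\<forall>A\<in>\<A>. \<forall>B\<in>\<A>. A o\<^sub>L B \<in> \<A>)"

definition standard_operator_algebra ::
  "('f::real_or_complex \<Rightarrow> 'x::banach \<Rightarrow> 'x) \<Rightarrow> ('x \<Rightarrow>\<^sub>L 'x) set \<Rightarrow> bool" where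
  "standard_operator_algebra smul \<A> \<longleftrightarrow>
    operator_subalgebra smul \<A> \<and>
    (\<forall>T\<in>bounded_operators smul. finite_rank smul T \<longrightarrow> T \<in> \<A>)"

definition additive_on :: "'a::ab_group_add set \<Rightarrow> ('a \<Rightarrow> 'b::ab_group_add) \<Rightarrow> bool" where
  "additive_on \<A> f \<longleftrightarrow> (\<forall>A\<in>\<A>. \<forall>B\<in>\<A>. f (A + B) = f A + f B)"

(* Only the values on \<A> of the total function f matter, here and below. *)
definition additive_operator_map ::
  "('f::real_or_complex \<Rightarrow> 'x::banach \<Rightarrow> 'x) \<Rightarrow> ('x \<Rightarrow>\<^sub>L 'x) set \<Rightarrow>
    (('x \<Rightarrow>\<^sub>L 'x) \<Rightarrow> ('x \<Rightarrow>\<^sub>L 'x)) \<Rightarrow> bool" where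
  "additive_operator_map smul \<A> f \<longleftrightarrow> f ` \<A> \<subseteq> bounded_operators smul \<and> additive_on \<A> f"

definition xi_commutator ::
  "('f::real_or_complex \<Rightarrow> 'x::banach \<Rightarrow> 'x) \<Rightarrow> 'f \<Rightarrow>
    ('x \<Rightarrow>\<^sub>L 'x) \<Rightarrow> ('x \<Rightarrow>\<^sub>L 'x) \<Rightarrow> ('x \<Rightarrow>\<^sub>L 'x)" where
  "xi_commutator smul \<xi> A B = (A o\<^sub>L B) - op_scale smul \<xi> (B o\<^sub>L A)"

definition commutator ::
  "('x::banach \<Rightarrow>\<^sub>L 'x) \<Rightarrow> ('x \<Rightarrow>\<^sub>L 'x) \<Rightarrow> ('x \<Rightarrow>\<^sub>L 'x)" where
  "commutator A B = (A o\<^sub>L B) - (B o\<^sub>L A)"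

definition additive_xi_Lie_derivation ::
  "('f::real_or_complex \<Rightarrow> 'x::banach \<Rightarrow> 'x) \<Rightarrow> 'f \<Rightarrow> ('x \<Rightarrow>\<^sub>L 'x) set \<Rightarrow>
    (('x \<Rightarrow>\<^sub>L 'x) \<Rightarrow> ('x \<Rightarrow>\<^sub>L 'x)) \<Rightarrow> bool" where
  "additive_xi_Lie_derivation smul \<xi> \<A> L \<longleftrightarrow>
    additive_operator_map smul \<A> L \<and>
    (\<forall>A\<in>\<A>. \<forall>B\<in>\<A>. L (xi_commutator smul \<xi> A B) =
      xi_commutator smul \<xi> (L A) B + xi_commutator smul \<xi> A (L B))"

definition additive_generalized_xi_Lie_derivation ::
  "('f::real_or_complex \<Rightarrow> 'x::banach \<Rightarrow> 'x) \<Rightarrow> 'f \<Rightarrow> ('x \<Rightarrow>\<^sub>L 'x) set \<Rightarrow>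
    (('x \<Rightarrow>\<^sub>L 'x) \<Rightarrow> ('x \<Rightarrow>\<^sub>L 'x)) \<Rightarrow> bool" where
  "additive_generalized_xi_Lie_derivation smul \<xi> \<A> \<delta> \<longleftrightarrow>
    additive_operator_map smul \<A> \<delta> \<and>
    (\<exists>L. additive_xi_Lie_derivation smul \<xi> \<A> L \<and>
      (\<forall>A\<in>\<A>. \<forall>B\<in>\<A>. \<delta> (xi_commutator smul \<xi> A B) =
        (\<delta> A o\<^sub>L B) - op_scale smul \<xi> (\<delta> B o\<^sub>L A)
        + (A o\<^sub>L L B) - op_scale smul \<xi> (B o\<^sub>L L A)))"

definition additive_derivation ::
  "('f::real_or_complex \<Rightarrow> 'x::banach \<Rightarrow> 'x) \<Rightarrow> ('x \<Rightarrow>\<^sub>L 'x) set \<Rightarrow>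
    (('x \<Rightarrow>\<^sub>L 'x) \<Rightarrow> ('x \<Rightarrow>\<^sub>L 'x)) \<Rightarrow> bool" where
  "additive_derivation smul \<A> d \<longleftrightarrow>
    additive_operator_map smul \<A> d \<and>
    (\<forall>A\<in>\<A>. \<forall>B\<in>\<A>. d (A o\<^sub>L B) = (d A o\<^sub>L B) + (A o\<^sub>L d B))"

definition additive_generalized_derivation ::
  "('f::real_or_complex \<Rightarrow> 'x::banach \<Rightarrow> 'x) \<Rightarrow> ('x \<Rightarrow>\<^sub>L 'x) set \<Rightarrow>
    (('x \<Rightarrow>\<^sub>L 'x) \<Rightarrow> ('x \<Rightarrow>\<^sub>L 'x)) \<Rightarrow> bool" where
  "additive_generalized_derivation smul \<A> \<tau> \<longleftrightarrow>
    additive_operator_map smul \<A> \<tau> \<and>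
    (\<exists>d. additive_derivation smul \<A> d \<and>
      (\<forall>A\<in>\<A>. \<forall>B\<in>\<A>. \<tau> (A o\<^sub>L B) = (\<tau> A o\<^sub>L B) + (A o\<^sub>L d B)))"

end

theory Submission imports Defs begin

text \<open>
  The difference \<open>\<phi> = \<delta> - L\<close> satisfies \<open>\<phi>([A,B]\<^sub>\<xi>) = \<phi>(A)B - \<xi>\<phi>(B)A\<close>; comparing the pairs
  \<open>(I,A)\<close> and \<open>(A,I)\<close> gives \<open>\<phi>(A) = \<phi>(I)A\<close>, so everything reduces to the \<open>\<xi>\<close>-Lie derivation \<open>L\<close>.

  If \<open>\<xi> \<noteq> 1\<close>, then \<open>L(I) = cI\<close> (with \<open>c = 0\<close> for \<open>\<xi> = -1\<close>) and \<open>D(A) = L(A) - cA\<close> is a Jordan derivation,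
  hence a derivation. The \<open>\<xi>\<close>-Lie identity for \<open>D + c\<close> then yields \<open>c(AB - BA) = 0\<close>, so \<open>c = 0\<close> and
  \<open>D(\<xi>A) = \<xi>D(A)\<close> as soon as \<open>X\<close> is not a line.

  Jordan derivations and, for \<open>\<xi> = 1\<close>, Lie derivations are treated by the Peirce decomposition of an
  idempotent \<open>p\<close> of rank one. After subtraction of an inner derivation (and, in the Lie case, of a
  scalar-valued map read off from the diagonal corners) the map preserves all four corners, and a
  corner-preserving map is a derivation once it is one on most pairs of corners.

  The functionals defining operators of rank one come from the Hahn-Banach theorem, which follows
  from the fact that a minimal sublinear functional is linear.
\<close>

section \<open>Norming functionals\<close>

definition sublinear :: "('x::real_vector \<Rightarrow> real) \<Rightarrow> bool" where
  "sublinear p \<longleftrightarrow> (\<forall>u v. p (u + v) \<le> p u + p v) \<and> (\<forall>c\<ge>0. \<forall>v. p (c *\<^sub>R v) = c * p v)"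

lemma sublinear_add: "sublinear p \<Longrightarrow> p (u + v) \<le> p u + p v"
  and sublinear_scale: "sublinear p \<Longrightarrow> 0 \<le> c \<Longrightarrow> p (c *\<^sub>R v) = c * p v"
  by (auto simp: sublinear_def)

lemma sublinear_zero: "sublinear p \<Longrightarrow> p 0 = 0"
  using sublinear_scale[of p 0 0] by simp

lemma sublinear_minus: "sublinear p \<Longrightarrow> - p (- v) \<le> p v"
  using sublinear_add[of p v "- v"] sublinear_zero[of p] by simp

text \<open>One inequality suffices for homogeneity: applied to \<open>inverse c\<close> and
  \<open>c *\<^sub>R v\<close> it gives the reverse one.\<close>

lemma sublinearI:
  assumes "\<And>u v. p (u + v) \<le> p u + p v" and "p 0 = 0"
    and le: "\<And>c v. 0 < c \<Longrightarrow> p (c *\<^sub>R v) \<le> c * p v"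
  shows "sublinear p"
  unfolding sublinear_def
proof (intro conjI allI impI)
  fix c :: real and v
  assume "0 \<le> c"
  show "p (c *\<^sub>R v) = c * p v"
  proof (cases "c = 0")
    case False
    with \<open>0 \<le> c\<close> have c: "0 < c" by simp
    have "p v \<le> inverse c * p (c *\<^sub>R v)"
      using le[of "inverse c" "c *\<^sub>R v"] c by simp
    then have "c * p v \<le> p (c *\<^sub>R v)"
      using c by (simp add: field_simps)
    with le[OF c, of v] show ?thesis by simp
  qed (simp add: assms(2))
qed (fact assms(1))

text \<open>The largest sublinear minorant of \<open>p\<close> whose value at \<open>-y\<close> is \<open>-p(y)\<close>.\<close>

definition tilt :: "'x::real_vector \<Rightarrow> ('x \<Rightarrow> real) \<Rightarrow> 'x \<Rightarrow> real" where
  "tilt y p v = (INF t\<in>{0..}. p (v + t *\<^sub>R y) - t * p y)"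

lemma tilt_le:
  assumes "sublinear p" "0 \<le> t"
  shows "tilt y p v \<le> p (v + t *\<^sub>R y) - t * p y"
  unfolding tilt_def
proof (rule cINF_lower)
  \<comment> \<open>A bound free of \<open>t\<close> makes the infimum in \<open>tilt\<close> a
    genuine lower bound.\<close>
  have "- p (- v) \<le> p (v + t *\<^sub>R y) - t * p y" if "0 \<le> t" for t
    using sublinear_add[OF assms(1), of "v + t *\<^sub>R y" "- v"] sublinear_scale[OF assms(1) that, of y]
    by simp
  then show "bdd_below ((\<lambda>t. p (v + t *\<^sub>R y) - t * p y) ` {0..})"
    by (intro bdd_belowI2[of _ "- p (- v)"]) auto
qed (use assms in simp)

lemma tilt_greatest:
  "(\<And>t. 0 \<le> t \<Longrightarrow> m \<le> p (v + t *\<^sub>R y) - t * p y) \<Longrightarrow> m \<le> tilt y p v"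
  unfolding tilt_def by (rule cINF_greatest) auto

lemma tilt_le_self: "sublinear p \<Longrightarrow> tilt y p v \<le> p v"
  using tilt_le[of p 0 y v] by simp

text \<open>Parameters add: the choices \<open>s\<close> for \<open>u\<close> and \<open>t\<close>
  for \<open>v\<close> give the choice \<open>s + t\<close> for \<open>u + v\<close>. For
  homogeneity, \<open>t\<close> is rescaled to \<open>c * t\<close>.\<close>

lemma sublinear_tilt:
  assumes p: "sublinear p"
  shows "sublinear (tilt y p)"
proof (rule sublinearI)
  fix u v
  have *: "tilt y p (u + v) \<le> (p (u + s *\<^sub>R y) - s * p y) + (p (v + t *\<^sub>R y) - t * p y)"
    if "0 \<le> s" "0 \<le> t" for s t
    using tilt_le[OF p, of "s + t" y "u + v"] that
      sublinear_add[OF p, of "u + s *\<^sub>R y" "v + t *\<^sub>R y"]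
    by (simp add: algebra_simps)
  have "tilt y p (u + v) - (p (u + s *\<^sub>R y) - s * p y) \<le> tilt y p v" if "0 \<le> s" for s
  proof (rule tilt_greatest)
    show "tilt y p (u + v) - (p (u + s *\<^sub>R y) - s * p y) \<le> p (v + t *\<^sub>R y) - t * p y"
      if "0 \<le> t" for t
      using *[OF \<open>0 \<le> s\<close> that] by linarith
  qed
  then have "tilt y p (u + v) - tilt y p v \<le> p (u + s *\<^sub>R y) - s * p y" if "0 \<le> s" for s
    using that by (simp add: algebra_simps)
  then have "tilt y p (u + v) - tilt y p v \<le> tilt y p u"
    by (rule tilt_greatest)
  then show "tilt y p (u + v) \<le> tilt y p u + tilt y p v" by simp
next
  show "tilt y p 0 = 0"
    using p by (simp add: tilt_def sublinear_scale cong: INF_cong_simp)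
next
  fix c :: real and v
  assume c: "0 < c"
  have "tilt y p (c *\<^sub>R v) \<le> c * (p (v + t *\<^sub>R y) - t * p y)" if "0 \<le> t" for t
    using tilt_le[OF p, of "c * t" y "c *\<^sub>R v"] c that sublinear_scale[OF p, of c "v + t *\<^sub>R y"]
    by (simp add: algebra_simps)
  then have "tilt y p (c *\<^sub>R v) / c \<le> tilt y p v"
    using c by (intro tilt_greatest) (simp add: field_simps)
  then show "tilt y p (c *\<^sub>R v) \<le> c * tilt y p v"
    using c by (simp add: field_simps)
qed

section \<open>Minimal sublinear functionals and the Hahn-Banach theorem\<close>

text \<open>Subadditivity survives the infimum because of two members of a chain one lies below
  both, so a single \<open>r\<close> serves \<open>u\<close> and \<open>v\<close> at once. The bound
  \<open>p0\<close> keeps the infimum finite: every member is at least \<open>- p0 (- v)\<close> at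
  \<open>v\<close>.\<close>

lemma sublinear_chain_Inf:
  assumes C: "C \<noteq> {}" "\<And>p. p \<in> C \<Longrightarrow> sublinear p"
    and chain: "\<And>p q. p \<in> C \<Longrightarrow> q \<in> C \<Longrightarrow> p \<le> q \<or> q \<le> p"
    and ub: "\<And>p. p \<in> C \<Longrightarrow> p \<le> p0"
  shows "sublinear (\<lambda>v. INF p\<in>C. p v)" and "\<And>p v. p \<in> C \<Longrightarrow> (INF p\<in>C. p v) \<le> p v"
proof -
  show lower: "(INF p\<in>C. p v) \<le> p v" if "p \<in> C" for p v
  proof (rule cINF_lower[OF _ that])
    have "- p0 (- v) \<le> p v" if "p \<in> C" for p
      using sublinear_minus[OF C(2)[OF that], of v] le_funD[OF ub[OF that], of "- v"] by simp
    then show "bdd_below ((\<lambda>p. p v) ` C)" by (intro bdd_belowI2)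
  qed
  show "sublinear (\<lambda>v. INF p\<in>C. p v)"
  proof (rule sublinearI)
    fix u v
    have *: "(INF p\<in>C. p (u + v)) \<le> p u + q v" if pq: "p \<in> C" "q \<in> C" for p q
    proof -
      obtain r where r: "r \<in> C" "r \<le> p" "r \<le> q"
        using chain[OF pq] pq by blast
      have "(INF p\<in>C. p (u + v)) \<le> r u + r v"
        using lower[OF r(1), of "u + v"] sublinear_add[OF C(2)[OF r(1)], of u v] by simp
      also have "\<dots> \<le> p u + q v"
        using le_funD[OF r(2), of u] le_funD[OF r(3), of v] by simp
      finally show ?thesis .
    qed
    have "(INF p\<in>C. p (u + v)) - p u \<le> (INF p\<in>C. p v)" if "p \<in> C" for p
      using *[OF that] by (intro cINF_greatest[OF C(1)]) (simp add: algebra_simps)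
    then have "(INF p\<in>C. p (u + v)) - (INF p\<in>C. p v) \<le> (INF p\<in>C. p u)"
      by (intro cINF_greatest[OF C(1)]) (simp add: algebra_simps)
    then show "(INF p\<in>C. p (u + v)) \<le> (INF p\<in>C. p u) + (INF p\<in>C. p v)" by simp
  next
    show "(INF p\<in>C. p 0) = 0"
      using C by (simp add: sublinear_zero cong: INF_cong_simp)
  next
    fix c :: real and v
    assume c: "0 < c"
    have "(INF p\<in>C. p (c *\<^sub>R v)) \<le> c * p v" if "p \<in> C" for p
      using lower[OF that, of "c *\<^sub>R v"] sublinear_scale[OF C(2)[OF that], of c v] c by simp
    then have "(INF p\<in>C. p (c *\<^sub>R v)) / c \<le> (INF p\<in>C. p v)"
      using c by (intro cINF_greatest[OF C(1)]) (simp add: field_simps)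
    then show "(INF p\<in>C. p (c *\<^sub>R v)) \<le> c * (INF p\<in>C. p v)"
      using c by (simp add: field_simps)
  qed
qed

text \<open>Zorn's lemma for the reversed pointwise order: a nonempty chain is bounded by its
  pointwise infimum, the empty one by \<open>p0\<close>.\<close>

lemma minimal_sublinear:
  assumes p0: "sublinear p0"
  obtains m where "sublinear m" "m \<le> p0" "\<And>p. sublinear p \<Longrightarrow> p \<le> m \<Longrightarrow> p = m"
proof -
  let ?A = "{p. sublinear p \<and> p \<le> p0}"
  have "\<exists>m\<in>?A. \<forall>a\<in>?A. a \<le> m \<longrightarrow> a = m"
  proof (rule predicate_Zorn)
    show "partial_order_on ?A (relation_of (\<lambda>p q. q \<le> p) ?A)"
      by (rule partial_order_on_relation_ofI) auto
  next
    fix C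
    assume C: "C \<in> Chains (relation_of (\<lambda>p q. q \<le> p) ?A)"
    show "\<exists>u\<in>?A. \<forall>a\<in>C. u \<le> a"
    proof (cases "C = {}")
      case False
      have in_A: "p \<in> ?A" if "p \<in> C" for p
        using C that by (auto simp: Chains_def relation_of_def)
      have chain: "p \<le> q \<or> q \<le> p" if "p \<in> C" "q \<in> C" for p q
        using C that by (auto simp: Chains_def relation_of_def)
      let ?u = "\<lambda>v. INF p\<in>C. p v"
      have u: "sublinear ?u" "\<And>p. p \<in> C \<Longrightarrow> ?u \<le> p"
        using sublinear_chain_Inf[OF False, of p0] in_A chain by (auto intro!: le_funI)
      obtain p where "p \<in> C" using False by blast
      then have "?u \<le> p0"
        using u(2) in_A by (blast intro: order_trans)
      with u show ?thesis by blast
    qed (use p0 in auto)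
  qed
  then obtain m where m: "m \<in> ?A" "\<And>a. a \<in> ?A \<Longrightarrow> a \<le> m \<Longrightarrow> a = m"
    by blast
  show thesis
  proof (rule that[of m])
    show "p = m" if "sublinear p" "p \<le> m" for p
      using m that by (auto intro: order_trans)
  qed (use m(1) in auto)
qed

text \<open>Tilting cannot lower a minimal functional, so \<open>tilt y m = m\<close> for every
  \<open>y\<close>. The parameter \<open>t = 1\<close> then gives
  \<open>m u \<le> m (u + v) - m v\<close>, the missing half of additivity.\<close>

lemma minimal_sublinear_linear:
  assumes m: "sublinear m" and minimal: "\<And>p. sublinear p \<Longrightarrow> p \<le> m \<Longrightarrow> p = m"
  shows "linear m"
proof -
  have tilt: "tilt y m = m" for y
    using minimal[OF sublinear_tilt[OF m]] tilt_le_self[OF m] by (simp add: le_fun_def)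
  have add: "m (u + v) = m u + m v" for u v
    using tilt_le[OF m, of 1 v u] sublinear_add[OF m, of u v] by (simp add: tilt)
  have minus: "m (- v) = - m v" for v
    using add[of v "- v"] sublinear_zero[OF m] by simp
  show ?thesis
  proof (rule linearI)
    show "m (c *\<^sub>R v) = c *\<^sub>R m v" for c v
    proof (cases "0 \<le> c")
      case False
      then show ?thesis
        using sublinear_scale[OF m, of "- c" v] minus[of "c *\<^sub>R v"] by simp
    qed (simp add: sublinear_scale[OF m])
  qed (fact add)
qed

text \<open>A minimal functional below the norm tilted at \<open>y\<close> works: the tilt is at
  most \<open>- norm y\<close> at \<open>- y\<close>, which forces \<open>m y\<close> up to
  \<open>norm y\<close>.\<close>

lemma real_norming_functional:
  fixes y :: "'x::real_normed_vector"
  obtains g :: "'x \<Rightarrow> real" where "bounded_linear g" "g y = norm y"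
proof -
  have norm: "sublinear (norm :: 'x \<Rightarrow> real)"
    by (simp add: sublinear_def norm_triangle_ineq)
  obtain m where m: "sublinear m" "m \<le> tilt y norm" "\<And>p. sublinear p \<Longrightarrow> p \<le> m \<Longrightarrow> p = m"
    using minimal_sublinear[OF sublinear_tilt[OF norm]] by blast
  have lin: "linear m"
    using minimal_sublinear_linear m by blast
  have le: "m v \<le> norm v" for v
    using le_funD[OF m(2), of v] tilt_le_self[OF norm, of y v] by simp
  have "\<bar>m v\<bar> \<le> norm v" for v
    using le[of v] le[of "- v"] linear_neg[OF lin, of v] by simp
  then have "bounded_linear m"
    by (intro linear_conv_bounded_linear[THEN iffD1] bounded_linear_intro[where K=1])
      (auto simp: linear_add[OF lin] linear_scale[OF lin])
  moreover have "m y = norm y"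
    using le[of y] le_funD[OF m(2), of "- y"] tilt_le[OF norm, of 1 y "- y"] linear_neg[OF lin, of y]
    by simp
  ultimately show thesis by (rule that)
qed

section \<open>Bounded functionals over the scalar field\<close>

context banach_space_over
begin

text \<open>\<open>bounded_linear\<close> gives linearity over the reals only; the second conjunct
  raises it to the scalar field.\<close>

definition functional :: "('x \<Rightarrow> 'f) \<Rightarrow> bool" where
  "functional f \<longleftrightarrow> bounded_linear f \<and> (\<forall>c v. f (smul c v) = c * f v)"

lemma functional_scale: "functional f \<Longrightarrow> f (smul c v) = c * f v"
  and functional_bounded_linear: "functional f \<Longrightarrow> bounded_linear f"
  by (simp_all add: functional_def)

lemma functional_zero: "functional f \<Longrightarrow> f 0 = 0"
  using functional_scale[of f 0 0] by simp

text \<open>Over a copy of the complex numbers, a real functional \<open>g\<close> is the real part of \<open>g(w) - i g(iw)\<close>.\<close>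

lemma ex_functional:
  assumes v: "v \<noteq> 0"
  obtains f where "functional f" "f v = 1"
proof -
  obtain g :: "'x \<Rightarrow> real" where g: "bounded_linear g" "g v = norm v"
    by (rule real_norming_functional)
  interpret g: bounded_linear g by fact
  consider (real) "\<forall>z::'f. \<exists>a. z = a *\<^sub>R 1"
    | (complex) i :: 'f where "i * i = - 1" "\<forall>z. \<exists>a b. z = a *\<^sub>R 1 + b *\<^sub>R i"
    using real_or_complex by blast
  then have "\<exists>f. functional f \<and> f v \<noteq> 0"
  proof cases
    case real
    have "functional (\<lambda>w. of_real (g w))"
      unfolding functional_def
    proof (intro conjI allI)
      show "bounded_linear (\<lambda>w. of_real (g w) :: 'f)"
        using g(1) by (rule bounded_linear_compose[OF bounded_linear_of_real])
      fix c :: 'f and w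
      obtain a where "c = of_real a"
        using real by (metis of_real_def)
      then show "of_real (g (smul c w)) = c * of_real (g w)"
        by (simp add: scale_of_real g.scaleR)
    qed
    then show ?thesis using g(2) v by (intro exI[of _ "\<lambda>w. of_real (g w)"]) simp
  next
    case complex
    let ?f = "\<lambda>w. of_real (g w) - i * of_real (g (smul i w)) :: 'f"
    have bl: "bounded_linear ?f"
      by (intro bounded_linear_sub bounded_linear_compose[OF bounded_linear_of_real]
          bounded_linear_compose[OF bounded_linear_mult_right] g(1)
          bounded_linear_compose[OF g(1)] bounded_linear_scale)
    have ii: "i * (i * z) = - z" for z
      using complex(1) by (metis mult.assoc mult_minus1)
    \<comment> \<open>Homogeneity for \<open>i\<close> and for real scalars yields it for every
      \<open>a + b * i\<close>.\<close>
    have fi: "?f (smul i w) = i * ?f w" for w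
      using complex(1) by (simp add: algebra_simps ii g.neg)
    have "functional ?f"
      unfolding functional_def
    proof (intro conjI allI bl)
      fix c :: 'f and w
      obtain a b where "c = a *\<^sub>R 1 + b *\<^sub>R i"
        using complex(2) by blast
      then have c: "c = of_real a + of_real b * i"
        by (simp add: of_real_def)
      have "smul c w = a *\<^sub>R w + b *\<^sub>R smul i w"
        unfolding c by (simp add: scale_left_distrib scale_of_real flip: scale_scale)
      then have "?f (smul c w) = a *\<^sub>R ?f w + b *\<^sub>R ?f (smul i w)"
        by (simp only: linear_add[OF bounded_linear.linear[OF bl]]
            linear_scale[OF bounded_linear.linear[OF bl]])
      also have "\<dots> = c * ?f w"
        unfolding fi unfolding c by (simp add: scaleR_conv_of_real algebra_simps)
      finally show "?f (smul c w) = c * ?f w" .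
    qed
    \<comment> \<open>If \<open>?f v\<close> vanished, squaring the resulting equation would make a
      sum of two real squares zero, whereas \<open>g v = norm v\<close> is nonzero.\<close>
    moreover have "?f v \<noteq> 0"
    proof
      assume "?f v = 0"
      then have "of_real (g v) = i * of_real (g (smul i v))" by simp
      then have "of_real (g v) * of_real (g v) =
          (i * i) * (of_real (g (smul i v)) * of_real (g (smul i v)) :: 'f)"
        by (simp add: algebra_simps)
      then have "of_real (g v * g v + g (smul i v) * g (smul i v)) = (0 :: 'f)"
        by (simp add: complex(1))
      then have "g v * g v + g (smul i v) * g (smul i v) = 0"
        by (simp only: of_real_eq_0_iff)
      then have "g v = 0" by (simp add: sum_squares_eq_zero_iff)
      with g(2) v show False by simp
    qed
    ultimately show ?thesis by blast
  qed
  then obtain f where f: "functional f" "f v \<noteq> 0" by blast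
  have "functional (\<lambda>w. inverse (f v) * f w)"
    using f(1) by (auto simp: functional_def intro: bounded_linear_compose[OF bounded_linear_mult_right])
  with f(2) show thesis
    by (intro that[of "\<lambda>w. inverse (f v) * f w"]) auto
qed

lemma functional_separates:
  assumes "\<And>f. functional f \<Longrightarrow> f u = f v"
  shows "u = v"
proof (rule ccontr)
  assume "u \<noteq> v"
  then obtain f where f: "functional f" "f (u - v) = 1"
    by (metis ex_functional right_minus_eq)
  then have "f u - f v = 1"
    using bounded_linear.linear[OF functional_bounded_linear] by (metis linear_diff)
  with assms[OF f(1)] show False by simp
qed

end

section \<open>Standard operator algebras and corners\<close>

notation blinfun_compose (infixl "\<cdot>" 70)

lemmas blinfun_compose_add_left = bounded_bilinear.add_left[OF bounded_bilinear_blinfun_compose]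
  and blinfun_compose_add_right = bounded_bilinear.add_right[OF bounded_bilinear_blinfun_compose]
  and blinfun_compose_diff_left = bounded_bilinear.diff_left[OF bounded_bilinear_blinfun_compose]
  and blinfun_compose_diff_right = bounded_bilinear.diff_right[OF bounded_bilinear_blinfun_compose]
  and blinfun_compose_minus_left = bounded_bilinear.minus_left[OF bounded_bilinear_blinfun_compose]
  and blinfun_compose_minus_right = bounded_bilinear.minus_right[OF bounded_bilinear_blinfun_compose]

lemma blinfun_compose_id [simp]: "id_blinfun \<cdot> A = A" "A \<cdot> id_blinfun = A"
  by (auto intro: blinfun_eqI)

lemma blinfun_compose_assoc: "A \<cdot> B \<cdot> C = A \<cdot> (B \<cdot> C)"
  by (auto intro: blinfun_eqI)

lemmas blinfun_compose_distrib = blinfun_compose_add_left blinfun_compose_add_right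
  blinfun_compose_diff_left blinfun_compose_diff_right
  blinfun_compose_minus_left blinfun_compose_minus_right

lemmas blinfun_compose_ring = blinfun_compose_distrib blinfun_compose_assoc

lemma double_eq_0_iff: "A + A = 0 \<longleftrightarrow> A = 0" for A :: "'a::real_vector"
  by (metis scaleR_2 scaleR_eq_0_iff zero_neq_numeral)

locale standard_algebra = banach_space_over smul
  for smul :: "'f::real_or_complex \<Rightarrow> 'x::banach \<Rightarrow> 'x" +
  fixes \<A> :: "('x \<Rightarrow>\<^sub>L 'x) set"
  assumes standard: "standard_operator_algebra smul \<A>"
    and id_mem: "id_blinfun \<in> \<A>"
begin

abbreviation \<B> :: "('x \<Rightarrow>\<^sub>L 'x) set" where "\<B> \<equiv> bounded_operators smul"

abbreviation scl :: "'f \<Rightarrow> ('x \<Rightarrow>\<^sub>L 'x) \<Rightarrow> 'x \<Rightarrow>\<^sub>L 'x" (infixr "\<odot>" 75)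
  where "c \<odot> T \<equiv> op_scale smul c T"

lemma B_scale: "T \<in> \<B> \<Longrightarrow> blinfun_apply T (smul c v) = smul c (blinfun_apply T v)"
  by (simp add: bounded_operators_def)

sublocale op: vector_space "op_scale smul"
  by unfold_locales
    (auto intro!: blinfun_eqI simp: op_scale_apply blinfun.add_left scale_right_distrib scale_left_distrib)

lemma scl_compose_left [simp]: "(c \<odot> A) \<cdot> B = c \<odot> (A \<cdot> B)"
  by (rule blinfun_eqI) (simp add: op_scale_apply)

lemma scl_compose_right [simp]: "A \<in> \<B> \<Longrightarrow> A \<cdot> (c \<odot> B) = c \<odot> (A \<cdot> B)"
  by (rule blinfun_eqI) (simp add: op_scale_apply B_scale)

lemma scl_minus_one: "(- 1) \<odot> A = - A"
  by (metis op.scale_minus_left op.scale_one)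

lemma B_add [intro]: "S \<in> \<B> \<Longrightarrow> T \<in> \<B> \<Longrightarrow> S + T \<in> \<B>"
  and B_minus [intro]: "S \<in> \<B> \<Longrightarrow> - S \<in> \<B>"
  and B_diff [intro]: "S \<in> \<B> \<Longrightarrow> T \<in> \<B> \<Longrightarrow> S - T \<in> \<B>"
  and B_compose [intro]: "S \<in> \<B> \<Longrightarrow> T \<in> \<B> \<Longrightarrow> S \<cdot> T \<in> \<B>"
  and B_scl [intro]: "S \<in> \<B> \<Longrightarrow> c \<odot> S \<in> \<B>"
  by (auto simp: bounded_operators_def blinfun.add_left blinfun.minus_left blinfun.diff_left
      op_scale_apply scale_right_distrib scale_right_diff_distrib mult.commute)

lemma subalgebra: "operator_subalgebra smul \<A>"
  using standard by (simp add: standard_operator_algebra_def)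

lemma A_B [intro]: "A \<in> \<A> \<Longrightarrow> A \<in> \<B>"
  and A_zero [intro]: "0 \<in> \<A>"
  and A_add [intro]: "A \<in> \<A> \<Longrightarrow> B \<in> \<A> \<Longrightarrow> A + B \<in> \<A>"
  and A_scl [intro]: "A \<in> \<A> \<Longrightarrow> c \<odot> A \<in> \<A>"
  and A_compose [intro]: "A \<in> \<A> \<Longrightarrow> B \<in> \<A> \<Longrightarrow> A \<cdot> B \<in> \<A>"
  using subalgebra by (auto simp: operator_subalgebra_def)

lemma A_minus [intro]: "A \<in> \<A> \<Longrightarrow> - A \<in> \<A>"
  by (metis A_scl scl_minus_one)

lemma A_diff [intro]: "A \<in> \<A> \<Longrightarrow> B \<in> \<A> \<Longrightarrow> A - B \<in> \<A>"
  using A_add[of A "- B"] by auto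

section \<open>Operators of rank at most one\<close>

text \<open>The tensor of the vector \<open>u\<close> with the functional \<open>f\<close>. These
  are the only operators that the proof takes from the standardness of \<A>.\<close>

definition rank_one :: "'x \<Rightarrow> ('x \<Rightarrow> 'f) \<Rightarrow> 'x \<Rightarrow>\<^sub>L 'x" where
  "rank_one u f = Blinfun (\<lambda>v. smul (f v) u)"

lemma rank_one_apply:
  assumes f: "functional f"
  shows "blinfun_apply (rank_one u f) v = smul (f v) u"
proof -
  have "bounded_linear (\<lambda>c. smul c u)"
  proof (rule bounded_linear_intro)
    show "smul (r *\<^sub>R c) u = r *\<^sub>R smul c u" for r c
      by (metis scaleR_conv_of_real scale_of_real scale_scale)
  qed (auto simp: scale_left_distrib norm_scale)
  then have "bounded_linear (\<lambda>v. smul (f v) u)"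
    using f by (rule bounded_linear_compose[OF _ functional_bounded_linear])
  then show ?thesis by (simp add: rank_one_def bounded_linear_Blinfun_apply)
qed

lemma rank_one_mem [intro]:
  assumes f: "functional f"
  shows "rank_one u f \<in> \<A>"
proof -
  have "rank_one u f \<in> \<B>"
    using f by (simp add: bounded_operators_def rank_one_apply functional_scale)
  moreover have "finite_rank smul (rank_one u f)"
    unfolding finite_rank_def
    using f by (intro exI[of _ "{u}"]) (auto simp: rank_one_apply span_singleton)
  ultimately show ?thesis
    using standard by (simp add: standard_operator_algebra_def)
qed

text \<open>Evaluating the commutation relation at \<open>x\<close> gives
  \<open>y = smul (f y) x\<close>, so every vector lies on the line of \<open>x\<close>.\<close>

lemma dim_eq_1_if_rank_one_commute:
  assumes "x \<noteq> 0"
    and "\<And>y f. functional f \<Longrightarrow> f x = 1 \<Longrightarrow>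
      rank_one y f \<cdot> rank_one x f = rank_one x f \<cdot> rank_one y f"
  shows "vector_space.dim smul UNIV = 1"
proof -
  obtain f where f: "functional f" "f x = 1"
    by (rule ex_functional[OF assms(1)])
  have "y = smul (f y) x" for y
    using arg_cong[OF assms(2)[OF f, of y], of "\<lambda>T. blinfun_apply T x"] f
    by (simp add: rank_one_apply)
  then have "span {x} = UNIV"
    unfolding span_singleton by auto
  then show ?thesis
    using dim_eq_card[of "{x}" UNIV] assms(1) by simp
qed

text \<open>Commuting with \<open>rank_one u f\<close> and evaluating at an \<open>x\<close> with
  \<open>f x = 1\<close> shows that \<open>T\<close> multiplies \<open>u\<close> by
  \<open>f (T x)\<close>, a factor independent of \<open>u\<close>. On the zero space any scalar
  works.\<close>

lemma commutant_scalar: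
  assumes T: "T \<in> \<B>" and comm: "\<And>A. A \<in> \<A> \<Longrightarrow> T \<cdot> A = A \<cdot> T"
  obtains c where "T = c \<odot> id_blinfun"
proof (cases "\<exists>x::'x. x \<noteq> 0")
  case True
  then obtain x :: 'x where "x \<noteq> 0" by blast
  then obtain f where f: "functional f" "f x = 1"
    by (rule ex_functional)
  have "T = f (blinfun_apply T x) \<odot> id_blinfun"
  proof (rule blinfun_eqI)
    fix u
    have "blinfun_apply (T \<cdot> rank_one u f) x = blinfun_apply (rank_one u f \<cdot> T) x"
      using comm[OF rank_one_mem[OF f(1)]] by simp
    then show "blinfun_apply T u = blinfun_apply (f (blinfun_apply T x) \<odot> id_blinfun) u"
      using f by (simp add: rank_one_apply op_scale_apply)
  qed
  then show thesis by (rule that)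
next
  case False
  then show thesis by (intro that[of 0] blinfun_eqI) metis
qed

section \<open>Additive maps and derivations on the algebra\<close>

definition derivation :: "(('x \<Rightarrow>\<^sub>L 'x) \<Rightarrow> 'x \<Rightarrow>\<^sub>L 'x) \<Rightarrow> bool" where
  "derivation = additive_derivation smul \<A>"

definition additive_map :: "(('x \<Rightarrow>\<^sub>L 'x) \<Rightarrow> 'x \<Rightarrow>\<^sub>L 'x) \<Rightarrow> bool" where
  "additive_map = additive_operator_map smul \<A>"

lemma derivationI:
  assumes "additive_map D" "\<And>A B. A \<in> \<A> \<Longrightarrow> B \<in> \<A> \<Longrightarrow> D (A \<cdot> B) = D A \<cdot> B + A \<cdot> D B"
  shows "derivation D"
  using assms by (simp add: derivation_def additive_derivation_def additive_map_def)

lemma derivation_additive: "derivation D \<Longrightarrow> additive_map D"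
  and derivation_mult: "derivation D \<Longrightarrow> A \<in> \<A> \<Longrightarrow> B \<in> \<A> \<Longrightarrow> D (A \<cdot> B) = D A \<cdot> B + A \<cdot> D B"
  by (simp_all add: derivation_def additive_derivation_def additive_map_def)

lemma additive_mapI:
  assumes "\<And>A. A \<in> \<A> \<Longrightarrow> D A \<in> \<B>" "\<And>A B. A \<in> \<A> \<Longrightarrow> B \<in> \<A> \<Longrightarrow> D (A + B) = D A + D B"
  shows "additive_map D"
  using assms by (auto simp: additive_map_def additive_operator_map_def additive_on_def)

lemma additive_map_mem: "additive_map D \<Longrightarrow> A \<in> \<A> \<Longrightarrow> D A \<in> \<B>"
  and additive_map_add: "additive_map D \<Longrightarrow> A \<in> \<A> \<Longrightarrow> B \<in> \<A> \<Longrightarrow> D (A + B) = D A + D B"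
  by (auto simp: additive_map_def additive_operator_map_def additive_on_def)

lemma additive_map_zero: "additive_map D \<Longrightarrow> D 0 = 0"
  using additive_map_add[of D 0 0] by auto

lemma additive_map_minus:
  assumes "additive_map D" "A \<in> \<A>"
  shows "D (- A) = - D A"
proof -
  have "D (- A) + D A = D (- A + A)"
    using assms by (intro additive_map_add[symmetric]) auto
  then show ?thesis
    using additive_map_zero[OF assms(1)] by (simp add: eq_neg_iff_add_eq_0)
qed

lemma additive_map_diff:
  "additive_map D \<Longrightarrow> A \<in> \<A> \<Longrightarrow> B \<in> \<A> \<Longrightarrow> D (A - B) = D A - D B"
  using additive_map_add[of D A "- B"] additive_map_minus[of D B] by auto

lemma additive_map_plus:
  "additive_map D \<Longrightarrow> additive_map E \<Longrightarrow> additive_map (\<lambda>A. D A + E A)"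
  by (rule additive_mapI) (auto simp: additive_map_add additive_map_mem)

lemma derivation_plus:
  "derivation D \<Longrightarrow> derivation E \<Longrightarrow> derivation (\<lambda>A. D A + E A)"
  by (rule derivationI)
    (auto intro: additive_map_plus derivation_additive simp: derivation_mult blinfun_compose_distrib)

lemma derivation_inner:
  "S \<in> \<B> \<Longrightarrow> derivation (\<lambda>A. A \<cdot> S - S \<cdot> A)"
  by (intro derivationI additive_mapI) (auto simp: blinfun_compose_ring)

end

section \<open>Peirce corners of an idempotent of rank one\<close>

locale peirce = standard_algebra smul \<A>
  for smul :: "'f::real_or_complex \<Rightarrow> 'x::banach \<Rightarrow> 'x" and \<A> +
  fixes x :: 'x and f :: "'x \<Rightarrow> 'f"
  assumes f: "functional f" and fx: "f x = 1"
begin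

text \<open>The idempotent p of rank one and its complement q = 1 - p. Indexing them by
  \<open>bool\<close> lets one statement about \<open>i\<close> and \<open>j\<close> cover all four
  corners.\<close>

definition e :: "bool \<Rightarrow> 'x \<Rightarrow>\<^sub>L 'x" where
  "e i = (if i then rank_one x f else id_blinfun - rank_one x f)"

text \<open>The Peirce corner with indices \<open>i\<close>, \<open>j\<close>, given as the fixed
  points of the compression onto it. Membership in \<A> or \<B> is stated separately wherever it
  matters.\<close>

definition corner :: "bool \<Rightarrow> bool \<Rightarrow> ('x \<Rightarrow>\<^sub>L 'x) \<Rightarrow> bool" where
  "corner i j T \<longleftrightarrow> e i \<cdot> T \<cdot> e j = T"

lemma x_nonzero: "x \<noteq> 0"
  using fx functional_zero[OF f] by auto

lemma e_mem [intro, simp]: "e i \<in> \<A>"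
  unfolding e_def using A_diff[OF id_mem rank_one_mem[OF f]] rank_one_mem[OF f] by simp

lemma e_mem_B [simp]: "e i \<in> \<B>"
  by (rule A_B) (rule e_mem)

lemma e_True_apply: "blinfun_apply (e True) v = smul (f v) x"
  by (simp add: e_def rank_one_apply f)

lemma e_mult: "e i \<cdot> e j = (if i = j then e i else 0)"
proof -
  have *: "rank_one x f \<cdot> rank_one x f = rank_one x f"
    by (rule blinfun_eqI) (simp add: rank_one_apply f functional_scale fx)
  show ?thesis
    by (cases i; cases j) (simp_all add: e_def blinfun_compose_distrib *)
qed

lemma e_mult_left: "e i \<cdot> (e j \<cdot> T) = (if i = j then e i \<cdot> T else 0)"
  by (simp add: e_mult flip: blinfun_compose_assoc)

lemma e_sum: "e True + e False = id_blinfun"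
  by (simp add: e_def)

lemma corner_cut [intro, simp]: "corner i j (e i \<cdot> T \<cdot> e j)"
  by (simp add: corner_def blinfun_compose_assoc e_mult e_mult_left)

lemma corner_left:
  assumes "corner i j T"
  shows "e k \<cdot> T = (if k = i then T else 0)"
proof -
  have T: "e i \<cdot> T \<cdot> e j = T"
    using assms by (simp only: corner_def)
  have "e k \<cdot> (e i \<cdot> T \<cdot> e j) = (if k = i then e i \<cdot> T \<cdot> e j else 0)"
    by (simp add: blinfun_compose_assoc e_mult_left)
  then show ?thesis by (simp only: T)
qed

lemma corner_right:
  assumes "corner i j T"
  shows "T \<cdot> e k = (if k = j then T else 0)"
proof -
  have T: "e i \<cdot> T \<cdot> e j = T"
    using assms by (simp only: corner_def)
  have "e i \<cdot> T \<cdot> e j \<cdot> e k = (if k = j then e i \<cdot> T \<cdot> e j else 0)"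
    by (simp add: blinfun_compose_assoc e_mult)
  then show ?thesis by (simp only: T)
qed

lemma corner_iff: "corner i j T \<longleftrightarrow> e i \<cdot> T = T \<and> T \<cdot> e j = T"
proof
  show "corner i j T" if "e i \<cdot> T = T \<and> T \<cdot> e j = T"
    using that by (simp add: corner_def)
qed (simp add: corner_left corner_right)

lemma corner_left': "corner i j T \<Longrightarrow> e k \<cdot> (T \<cdot> S) = (if k = i then T \<cdot> S else 0)"
  by (simp add: corner_left flip: blinfun_compose_assoc)

lemma corner_right': "corner i j T \<Longrightarrow> T \<cdot> (e k \<cdot> S) = (if k = j then T \<cdot> S else 0)"
  by (simp add: corner_right flip: blinfun_compose_assoc)

lemma corner_add [intro]: "corner i j S \<Longrightarrow> corner i j T \<Longrightarrow> corner i j (S + T)"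
  and corner_diff [intro]: "corner i j S \<Longrightarrow> corner i j T \<Longrightarrow> corner i j (S - T)"
  by (simp_all add: corner_def blinfun_compose_distrib)

lemma corner_compose [intro]: "corner i j S \<Longrightarrow> corner j k T \<Longrightarrow> corner i k (S \<cdot> T)"
  by (simp add: corner_iff blinfun_compose_assoc flip: blinfun_compose_assoc[of "e i"])

lemma corner_zero:
  assumes "corner i j S" "corner k l T" "j \<noteq> k"
  shows "S \<cdot> T = 0"
  using corner_right'[OF assms(1), of k T] corner_left[OF assms(2), of k] assms(3) by simp

lemma corner_sum:
  "T = e True \<cdot> T \<cdot> e True + e True \<cdot> T \<cdot> e False + e False \<cdot> T \<cdot> e True + e False \<cdot> T \<cdot> e False"
proof -
  have "T = (e True + e False) \<cdot> T \<cdot> (e True + e False)"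
    by (simp add: e_sum)
  then show ?thesis
    by (simp only: blinfun_compose_ring add_ac)
qed

text \<open>Every operator of \<A> is a sum of four operators of \<A> that lie in corners, so an
  additive statement needs checking on corners only.\<close>

lemma corner_induct [consumes 1, case_names corner add]:
  assumes "A \<in> \<A>" and "\<And>i j A. A \<in> \<A> \<Longrightarrow> corner i j A \<Longrightarrow> P A"
    and "\<And>A B. A \<in> \<A> \<Longrightarrow> B \<in> \<A> \<Longrightarrow> P A \<Longrightarrow> P B \<Longrightarrow> P (A + B)"
  shows "P A"
proof -
  have "P (e i \<cdot> A \<cdot> e j)" for i j
    using assms(1,2) by blast
  then show ?thesis
    by (subst corner_sum) (intro assms(3) A_add A_compose e_mem assms(1))
qed

text \<open>p maps onto the line of \<open>x\<close>, so its corner consists of the multiples of p.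
  In particular this corner is commutative.\<close>

lemma corner_True_eq:
  assumes "corner True True T" "T \<in> \<B>"
  shows "T = f (blinfun_apply T x) \<odot> e True"
proof (rule blinfun_eqI)
  fix v
  have "blinfun_apply T v = blinfun_apply (e True \<cdot> T \<cdot> e True) v"
    using assms(1) by (simp add: corner_def)
  also have "\<dots> = smul (f v) (smul (f (blinfun_apply T x)) x)"
    using assms(2) by (simp add: e_True_apply B_scale f functional_scale mult.commute)
  finally show "blinfun_apply T v = blinfun_apply (f (blinfun_apply T x) \<odot> e True) v"
    by (simp add: op_scale_apply e_True_apply mult.commute)
qed

text \<open>Off-diagonal operators separate the elements of a diagonal corner. In the corner of p,
  the test operator built from a \<open>y\<close> with \<open>e False\<close> nonzero at
  \<open>y\<close> detects \<open>f (T x)\<close>, which determines \<open>T\<close>. In the other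
  corner, the operators built from \<open>rank_one x g\<close> detect every \<open>g (T v)\<close>.
  The last assumption ensures that the first kind of test operator exists.\<close>

lemma off_diagonal_faithful:
  assumes T: "corner i i T" "T \<in> \<B>"
    and ann: "\<And>S. S \<in> \<A> \<Longrightarrow> corner (\<not> i) i S \<Longrightarrow> S \<cdot> T = 0"
    and i: "i \<Longrightarrow> e False \<noteq> 0"
  shows "T = 0"
proof (cases i)
  case True
  obtain y where y: "blinfun_apply (e False) y \<noteq> 0"
    using i[OF True] by (metis blinfun_eqI zero_blinfun.rep_eq)
  have "(e False \<cdot> rank_one y f \<cdot> e True) \<cdot> T = 0"
    using True f by (intro ann A_compose) auto
  then have "blinfun_apply (e False \<cdot> rank_one y f \<cdot> (e True \<cdot> T)) x = 0"
    by (simp add: blinfun_compose_assoc)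
  then have "f (blinfun_apply T x) = 0"
    using T True y by (simp add: corner_left rank_one_apply f B_scale)
  then show ?thesis
    using corner_True_eq T True by (metis op.scale_zero_left)
next
  case False
  show ?thesis
  proof (rule blinfun_eqI, rule functional_separates)
    fix v g
    assume g: "functional g"
    have "(e True \<cdot> rank_one x g \<cdot> e False) \<cdot> T = 0"
      using False g by (intro ann A_compose) auto
    then have "blinfun_apply (e True \<cdot> rank_one x g \<cdot> (e False \<cdot> T)) v = 0"
      by (simp add: blinfun_compose_assoc)
    then have "g (blinfun_apply T v) = 0"
      using T False x_nonzero by (simp add: corner_left rank_one_apply g B_scale e_True_apply fx functional_scale[OF f])
    then show "g (blinfun_apply T v) = g (blinfun_apply 0 v)"
      by (simp add: functional_zero[OF g])
  qed
qed

text \<open>The product rule is transferred from off-diagonal pairs: expanding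
  \<open>D (S \<cdot> A \<cdot> B)\<close> along both bracketings shows that every off-diagonal
  \<open>S\<close> annihilates the defect of the rule.\<close>

lemma diagonal_mult:
  assumes D: "additive_map D"
    and pres: "\<And>i j A. A \<in> \<A> \<Longrightarrow> corner i j A \<Longrightarrow> corner i j (D A)"
    and mult: "\<And>A B. A \<in> \<A> \<Longrightarrow> B \<in> \<A> \<Longrightarrow> corner (\<not> i) i A \<Longrightarrow> corner i i B \<Longrightarrow>
      D (A \<cdot> B) = D A \<cdot> B + A \<cdot> D B"
    and i: "i \<Longrightarrow> e False \<noteq> 0"
    and A: "A \<in> \<A>" "corner i i A" and B: "B \<in> \<A>" "corner i i B"
  shows "D (A \<cdot> B) = D A \<cdot> B + A \<cdot> D B"
proof -
  have "D (A \<cdot> B) - (D A \<cdot> B + A \<cdot> D B) = 0"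
  proof (rule off_diagonal_faithful[where i = i])
    show "corner i i (D (A \<cdot> B) - (D A \<cdot> B + A \<cdot> D B))"
      using A B pres[OF A] pres[OF B] pres[OF A_compose[OF A(1) B(1)] corner_compose[OF A(2) B(2)]]
      by (intro corner_diff corner_add corner_compose)
    show "D (A \<cdot> B) - (D A \<cdot> B + A \<cdot> D B) \<in> \<B>"
      using A B additive_map_mem[OF D] by (intro B_diff B_add B_compose) auto
    fix S
    assume S: "S \<in> \<A>" "corner (\<not> i) i S"
    have "D (S \<cdot> A \<cdot> B) = (D S \<cdot> A + S \<cdot> D A) \<cdot> B + S \<cdot> A \<cdot> D B"
      using mult[OF S(1) A(1) S(2) A(2)] mult[of "S \<cdot> A" B] S A B by auto
    moreover have "D (S \<cdot> (A \<cdot> B)) = D S \<cdot> (A \<cdot> B) + S \<cdot> D (A \<cdot> B)"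
      using S A B by (intro mult) auto
    ultimately show "S \<cdot> (D (A \<cdot> B) - (D A \<cdot> B + A \<cdot> D B)) = 0"
      by (simp add: blinfun_compose_ring)
  qed (use i in auto)
  then show ?thesis by simp
qed

text \<open>Pairs with different inner indices have zero products because \<open>D\<close> preserves
  corners, and pairs inside the \<open>False\<close> corner follow from
  \<open>diagonal_mult\<close>. Additivity in each factor extends the rule from corners to
  \<A>.\<close>

lemma peirce_derivation:
  assumes D: "additive_map D"
    and pres: "\<And>i j A. A \<in> \<A> \<Longrightarrow> corner i j A \<Longrightarrow> corner i j (D A)"
    and mult: "\<And>i j k A B. A \<in> \<A> \<Longrightarrow> B \<in> \<A> \<Longrightarrow> corner i j A \<Longrightarrow> corner j k B \<Longrightarrow> i \<or> j \<or> k \<Longrightarrow>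
      D (A \<cdot> B) = D A \<cdot> B + A \<cdot> D B"
  shows "derivation D"
proof -
  have corners: "D (A \<cdot> B) = D A \<cdot> B + A \<cdot> D B"
    if A: "A \<in> \<A>" "corner i j A" and B: "B \<in> \<A>" "corner k l B" for i j k l A B
  proof (cases "j = k")
    case True
    show ?thesis
    proof (cases "i \<or> j \<or> l")
      case False
      with A B True show ?thesis
        using diagonal_mult[of D False A B] D pres mult by auto
    qed (use A B True mult in blast)
  next
    case False
    then have "A \<cdot> B = 0" "D A \<cdot> B = 0" "A \<cdot> D B = 0"
      using A B pres by (blast intro: corner_zero)+
    then show ?thesis by (simp add: additive_map_zero[OF D])
  qed
  have "D (A \<cdot> B) = D A \<cdot> B + A \<cdot> D B" if A: "A \<in> \<A>" "corner i j A" and B: "B \<in> \<A>" for i j A B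
    using B
  proof (induction B rule: corner_induct)
    case (corner k l B)
    then show ?case using corners A by blast
  next
    case (add B C)
    then show ?case
      using A by (simp add: blinfun_compose_distrib additive_map_add[OF D] A_compose)
  qed
  note left_corner = this
  show ?thesis
  proof (rule derivationI[OF D])
    fix A B
    assume "A \<in> \<A>" and B: "B \<in> \<A>"
    then show "D (A \<cdot> B) = D A \<cdot> B + A \<cdot> D B"
    proof (induction A rule: corner_induct)
      case (corner k l A)
      then show ?case using left_corner B by blast
    next
      case (add A C)
      then show ?case
        using B by (simp add: blinfun_compose_distrib additive_map_add[OF D] A_compose)
    qed
  qed
qed

section \<open>Jordan derivations\<close>

text \<open>One off-diagonal corner consists of maps into the line of \<open>x\<close>, the other of
  maps determined by their value at \<open>x\<close>. Hence one product already forces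
  \<open>N = 0\<close>: \<open>N \<cdot> A\<close> if \<open>i\<close> is true,
  \<open>A \<cdot> N\<close> if \<open>j\<close> is.\<close>

lemma opposite_corners_annihilate:
  assumes A: "corner i j A" "A \<in> \<B>" "A \<noteq> 0" and N: "corner j i N" "N \<in> \<B>"
    and ij: "i \<noteq> j" and AN: "A \<cdot> N = 0" and NA: "N \<cdot> A = 0"
  shows "N = 0"
proof (cases i)
  case True
  obtain v where v: "blinfun_apply A v \<noteq> 0"
    using A(3) by (metis blinfun_eqI zero_blinfun.rep_eq)
  have "blinfun_apply A v = blinfun_apply (e True \<cdot> A) v"
    using A(1) True by (simp add: corner_left)
  then have Av: "blinfun_apply A v = smul (f (blinfun_apply A v)) x"
    by (simp add: e_True_apply)
  then have "f (blinfun_apply A v) \<noteq> 0"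
    using v by (metis scale_zero_left)
  moreover have "blinfun_apply N (blinfun_apply A v) = 0"
    using arg_cong[OF NA, of "\<lambda>T. blinfun_apply T v"] by simp
  ultimately have Nx: "blinfun_apply N x = 0"
    using Av N(2) by (metis B_scale scale_eq_0_iff)
  have "N = N \<cdot> e True"
    using N(1) True by (simp add: corner_right)
  then show ?thesis
    using Nx N(2) by (intro blinfun_eqI) (metis B_scale blinfun_apply_blinfun_compose e_True_apply
        scale_zero_right zero_blinfun.rep_eq)
next
  case False
  with ij have j: "j" by simp
  have "A = A \<cdot> e True"
    using A(1) j by (simp add: corner_right)
  then have Ax: "blinfun_apply A x \<noteq> 0"
    using A(2,3) by (metis B_scale blinfun_apply_blinfun_compose blinfun_eqI e_True_apply
        scale_zero_right zero_blinfun.rep_eq)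
  show ?thesis
  proof (rule blinfun_eqI)
    fix v
    have "blinfun_apply N v = blinfun_apply (e True \<cdot> N) v"
      using N(1) j by (simp add: corner_left)
    then have Nv: "blinfun_apply N v = smul (f (blinfun_apply N v)) x"
      by (simp add: e_True_apply)
    have "blinfun_apply A (blinfun_apply N v) = 0"
      using arg_cong[OF AN, of "\<lambda>T. blinfun_apply T v"] by simp
    then have "f (blinfun_apply N v) = 0"
      using Nv A(2) Ax by (metis B_scale scale_eq_0_iff)
    then show "blinfun_apply N v = blinfun_apply 0 v"
      using Nv by simp
  qed
qed

text \<open>The right-hand side counts the corner \<open>i\<close>, \<open>i\<close> twice, the
  off-diagonal corners once and the remaining corner not at all, while the left-hand side counts
  each twice.\<close>

lemma corner_if_twice:
  assumes "M + M = M \<cdot> e i + e i \<cdot> M"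
  shows "corner i i M"
proof -
  let ?d = "e (\<not> i)"
  have "?d \<cdot> (M + M) \<cdot> e i = ?d \<cdot> (M \<cdot> e i + e i \<cdot> M) \<cdot> e i"
    using assms by simp
  then have "?d \<cdot> M \<cdot> e i = 0"
    by (simp add: blinfun_compose_ring e_mult e_mult_left)
  moreover have "e i \<cdot> (M + M) \<cdot> ?d = e i \<cdot> (M \<cdot> e i + e i \<cdot> M) \<cdot> ?d"
    using assms by simp
  then have "e i \<cdot> M \<cdot> ?d = 0"
    by (simp add: blinfun_compose_ring e_mult e_mult_left)
  moreover have "?d \<cdot> (M + M) \<cdot> ?d = ?d \<cdot> (M \<cdot> e i + e i \<cdot> M) \<cdot> ?d"
    using assms by simp
  then have "?d \<cdot> M \<cdot> ?d = 0"
    by (simp add: blinfun_compose_ring e_mult e_mult_left double_eq_0_iff)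
  ultimately show ?thesis
    using corner_sum[of M] by (cases i) (simp_all add: corner_def)
qed

text \<open>\<open>D\<close> kills both idempotents, so Jordan products with \<open>e i\<close> show
  that it preserves corners. The product rule is then a component of the Jordan identity, except
  inside the corner of p, where commutativity makes it half of that identity.\<close>

lemma Jordan_derivation_normalized:
  assumes D: "additive_map D"
    and square: "\<And>A. A \<in> \<A> \<Longrightarrow> D (A \<cdot> A) = D A \<cdot> A + A \<cdot> D A"
    and p: "D (e True) = 0"
  shows "derivation D"
proof -
  have jordan: "D (A \<cdot> B + B \<cdot> A) = D A \<cdot> B + A \<cdot> D B + D B \<cdot> A + B \<cdot> D A"
    if A: "A \<in> \<A>" and B: "B \<in> \<A>" for A B
  proof -
    have "D ((A + B) \<cdot> (A + B)) = D (A \<cdot> A) + D (A \<cdot> B + B \<cdot> A) + D (B \<cdot> B)"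
      using A B by (simp add: blinfun_compose_distrib additive_map_add[OF D] A_add A_compose)
    then show ?thesis
      using square[of "A + B"] A B
      by (simp add: square additive_map_add[OF D] A_add blinfun_compose_distrib algebra_simps)
  qed
  have "D id_blinfun = 0"
    using square[OF id_mem] by simp
  then have "D (e False) = 0"
    using additive_map_diff[OF D id_mem e_mem[of True]] p
    by (simp flip: e_sum)
  with p have De: "D (e i) = 0" for i
    by (cases i) auto
  have pres: "corner i j (D A)" if A: "A \<in> \<A>" "corner i j A" for i j A
  proof (cases "i = j")
    case True
    have "D A + D A = D A \<cdot> e i + e i \<cdot> D A"
      using jordan[OF A(1) e_mem[of i]] A True
      by (simp add: De corner_left corner_right additive_map_add[OF D])
    then show ?thesis
      using corner_if_twice True by simp
  next
    case False
    let ?M = "D A"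
    have M: "?M = ?M \<cdot> e i + e i \<cdot> ?M"
      using jordan[OF A(1) e_mem[of i]] A False
      by (simp add: De corner_left corner_right)
    have "e i \<cdot> ?M \<cdot> e i = e i \<cdot> (?M \<cdot> e i + e i \<cdot> ?M) \<cdot> e i"
      using M by simp
    then have ii: "e i \<cdot> ?M \<cdot> e i = 0"
      by (simp add: blinfun_compose_ring e_mult e_mult_left)
    have "e j \<cdot> ?M \<cdot> e j = e j \<cdot> (?M \<cdot> e i + e i \<cdot> ?M) \<cdot> e j"
      using M by simp
    then have jj: "e j \<cdot> ?M \<cdot> e j = 0"
      using False by (simp add: blinfun_compose_ring e_mult e_mult_left)
    \<comment> \<open>So far both off-diagonal corners of \<open>?M\<close> may be nonzero. The
      relation obtained from the zero square of \<open>A\<close> removes the one opposite to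
      \<open>A\<close>.\<close>
    have "A \<cdot> A = 0"
      using A False by (metis corner_zero)
    then have MA: "?M \<cdot> A + A \<cdot> ?M = 0"
      using square[OF A(1)] by (simp add: additive_map_zero[OF D])
    let ?N = "e j \<cdot> ?M \<cdot> e i"
    have "?N = 0"
    proof (cases "A = 0")
      case True
      then show ?thesis by (simp add: additive_map_zero[OF D])
    next
      case nonzero: False
      show ?thesis
      proof (rule opposite_corners_annihilate[OF A(2) _ nonzero])
        have "e j \<cdot> (?M \<cdot> A + A \<cdot> ?M) = 0"
          using MA by simp
        then show "?N \<cdot> A = 0"
          using A(2) False
          by (simp add: blinfun_compose_ring corner_left corner_left')
        have "(?M \<cdot> A + A \<cdot> ?M) \<cdot> e i = 0"
          using MA by simp
        then show "A \<cdot> ?N = 0"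
          using A(2) False
          by (simp add: blinfun_compose_ring corner_right corner_right')
        show "?N \<in> \<B>"
          by (intro B_compose e_mem_B additive_map_mem[OF D] A(1))
      qed (use A False in auto)
    qed
    with ii jj False show ?thesis
      using corner_sum[of ?M] by (cases i; cases j) (simp_all add: corner_def)
  qed
  show ?thesis
  proof (rule peirce_derivation[OF D pres])
    fix i j k A B
    assume A: "A \<in> \<A>" "corner i j A" and B: "B \<in> \<A>" "corner j k B" and ijk: "i \<or> j \<or> k"
    have DA: "corner i j (D A)" and DB: "corner j k (D B)"
      using pres A B by auto
    consider "i \<noteq> k" | "i = k" "j \<noteq> i" | "i" "j" "k"
      using ijk by blast
    then show "D (A \<cdot> B) = D A \<cdot> B + A \<cdot> D B"
    proof cases
      case 1
      then have "B \<cdot> A = 0" "D B \<cdot> A = 0" "B \<cdot> D A = 0"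
        using A B DA DB by (auto intro: corner_zero)
      then show ?thesis
        using jordan[OF A(1) B(1)] by simp
    next
      \<comment> \<open>The two products lie in different diagonal corners, so multiplication by
        \<open>e i\<close> isolates the rule for \<open>A \<cdot> B\<close>.\<close>
      case 2
      have corners: "corner i i (D (A \<cdot> B))" "corner j j (D (B \<cdot> A))"
          "corner i i (D A \<cdot> B)" "corner i i (A \<cdot> D B)" "corner j j (D B \<cdot> A)" "corner j j (B \<cdot> D A)"
        using A B DA DB 2 by (auto intro: pres corner_compose)
      have "D (A \<cdot> B) + D (B \<cdot> A) = D A \<cdot> B + A \<cdot> D B + D B \<cdot> A + B \<cdot> D A"
        using jordan[OF A(1) B(1)] A B by (simp add: additive_map_add[OF D] A_compose)
      then have "e i \<cdot> (D (A \<cdot> B) + D (B \<cdot> A)) = e i \<cdot> (D A \<cdot> B + A \<cdot> D B + D B \<cdot> A + B \<cdot> D A)"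
        by simp
      then show ?thesis
        using corners 2 by (simp add: blinfun_compose_distrib corner_left)
    next
      case 3
      have comm: "S \<cdot> T = T \<cdot> S" if ST: "corner True True S" "S \<in> \<B>" "corner True True T" "T \<in> \<B>" for S T
      proof -
        obtain a b where "S = a \<odot> e True" "T = b \<odot> e True"
          using corner_True_eq[OF ST(1,2)] corner_True_eq[OF ST(3,4)] by blast
        then show ?thesis
          by (simp add: e_mult mult.commute)
      qed
      have "A \<cdot> B = B \<cdot> A" "D A \<cdot> B = B \<cdot> D A" "A \<cdot> D B = D B \<cdot> A"
        using A B DA DB 3 additive_map_mem[OF D] by (auto intro!: comm)
      then have "D (A \<cdot> B) + D (A \<cdot> B) = (D A \<cdot> B + A \<cdot> D B) + (D A \<cdot> B + A \<cdot> D B)"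
        using jordan[OF A(1) B(1)] A B by (simp add: additive_map_add[OF D] A_compose)
      then show ?thesis
        by (simp flip: scaleR_2)
    qed
  qed
qed

text \<open>With \<open>T\<close> the value of a map at p, adding the inner derivation given by
  \<open>S\<close> cancels the off-diagonal corners of this value and keeps the diagonal
  ones.\<close>

lemma inner_off_diagonal:
  fixes T :: "'x \<Rightarrow>\<^sub>L 'x"
  defines "S \<equiv> e False \<cdot> T \<cdot> e True - e True \<cdot> T \<cdot> e False"
  shows "T + (e True \<cdot> S - S \<cdot> e True) = e True \<cdot> T \<cdot> e True + e False \<cdot> T \<cdot> e False"
proof -
  have *: "e True \<cdot> S - S \<cdot> e True = - (e True \<cdot> T \<cdot> e False) - e False \<cdot> T \<cdot> e True"
    by (simp add: S_def blinfun_compose_ring e_mult e_mult_left)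
  show ?thesis
    unfolding * by (subst (1) corner_sum[of T]) simp
qed

text \<open>The square identity for p makes \<open>D (e True)\<close> purely off-diagonal, so an
  inner derivation removes it entirely; the one given by \<open>- S\<close> restores
  \<open>D\<close> afterwards.\<close>

lemma Jordan_derivation:
  assumes D: "additive_map D"
    and square: "\<And>A. A \<in> \<A> \<Longrightarrow> D (A \<cdot> A) = D A \<cdot> A + A \<cdot> D A"
  shows "derivation D"
proof -
  define T where "T = D (e True)"
  define S where "S = e False \<cdot> T \<cdot> e True - e True \<cdot> T \<cdot> e False"
  have T: "T \<in> \<B>"
    unfolding T_def using additive_map_mem[OF D] by simp
  then have S: "S \<in> \<B>"
    unfolding S_def by (intro B_diff B_compose) auto
  have TT: "T = T \<cdot> e True + e True \<cdot> T"
    using square[OF e_mem[of True]] by (simp add: e_mult T_def)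
  have "e i \<cdot> T \<cdot> e i = e i \<cdot> (T \<cdot> e True + e True \<cdot> T) \<cdot> e i" for i
    using TT by simp
  from this[of True] this[of False]
  have diag: "e True \<cdot> T \<cdot> e True = 0" "e False \<cdot> T \<cdot> e False = 0"
    by (simp_all add: blinfun_compose_ring e_mult e_mult_left)
  let ?E = "\<lambda>A. D A + (A \<cdot> S - S \<cdot> A)"
  have "derivation ?E"
  proof (rule Jordan_derivation_normalized)
    show "additive_map ?E"
      using D derivation_additive[OF derivation_inner[OF S]] by (rule additive_map_plus)
    show "?E (A \<cdot> A) = ?E A \<cdot> A + A \<cdot> ?E A" if "A \<in> \<A>" for A
      using that by (simp add: square blinfun_compose_ring algebra_simps)
    show "?E (e True) = 0"
      using inner_off_diagonal[of T] diag by (simp add: S_def T_def)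
  qed
  then have "derivation (\<lambda>A. ?E A + (A \<cdot> (- S) - (- S) \<cdot> A))"
    using derivation_inner[OF B_minus[OF S]] by (rule derivation_plus)
  then show ?thesis
    by (simp add: blinfun_compose_distrib)
qed

section \<open>Lie derivations\<close>

text \<open>A diagonal \<open>L (e True)\<close> turns out to be scalar, so \<open>L\<close>
  commutes with bracketing by p: off-diagonal corners are preserved, and operators in diagonal
  corners have diagonal images. Such an image has a scalar part in the opposite diagonal corner;
  subtracting this scalar \<open>h A\<close> leaves a map that preserves corners.\<close>

lemma Lie_derivation_normalized:
  assumes L: "additive_map L"
    and lie: "\<And>A B. A \<in> \<A> \<Longrightarrow> B \<in> \<A> \<Longrightarrow>
      L (A \<cdot> B - B \<cdot> A) = L A \<cdot> B - B \<cdot> L A + (A \<cdot> L B - L B \<cdot> A)"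
    and p: "L (e True) = e True \<cdot> L (e True) \<cdot> e True + e False \<cdot> L (e True) \<cdot> e False"
    and q: "e False \<noteq> 0"
  obtains D h where "derivation D" "additive_on \<A> h"
    "\<And>A B. A \<in> \<A> \<Longrightarrow> B \<in> \<A> \<Longrightarrow> h (A \<cdot> B - B \<cdot> A) = 0"
    "\<And>A. A \<in> \<A> \<Longrightarrow> L A = D A + h A \<odot> id_blinfun"
proof -
  let ?p = "e True" and ?q = "e False"
  define T where "T = L ?p"
  have T: "T \<in> \<B>"
    unfolding T_def using additive_map_mem[OF L] by simp
  have Tpq: "?p \<cdot> T \<cdot> ?q = 0"
  proof -
    have "?p \<cdot> T \<cdot> ?q = ?p \<cdot> (?p \<cdot> T \<cdot> ?p + ?q \<cdot> T \<cdot> ?q) \<cdot> ?q"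
      using p by (simp add: T_def)
    then show ?thesis by (simp add: blinfun_compose_ring e_mult e_mult_left)
  qed
  have pT: "?p \<cdot> T = ?p \<cdot> T \<cdot> ?p"
  proof -
    have "?p \<cdot> T \<cdot> ?p + ?p \<cdot> T \<cdot> ?q = ?p \<cdot> T"
      by (simp add: e_sum flip: blinfun_compose_add_right)
    then show ?thesis using Tpq by simp
  qed
  define t where "t = f (blinfun_apply (?p \<cdot> T \<cdot> ?p) x)"
  have tp: "?p \<cdot> T \<cdot> ?p = t \<odot> ?p"
    unfolding t_def using T by (intro corner_True_eq) (auto intro!: B_compose)
  \<comment> \<open>For \<open>A\<close> in the corner \<open>True\<close>, \<open>False\<close> the
    bracket of p and \<open>A\<close> is \<open>A\<close> itself. Compressing the Lie identity to
    this corner gives \<open>?p \<cdot> T \<cdot> A = A \<cdot> T \<cdot> ?q\<close>, so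
    \<open>T\<close> acts by the same scalar \<open>t\<close> in both diagonal corners.\<close>
  have tq: "?q \<cdot> T \<cdot> ?q - t \<odot> ?q = 0"
  proof (rule off_diagonal_faithful[of False])
    show "corner False False (?q \<cdot> T \<cdot> ?q - t \<odot> ?q)"
      by (simp add: corner_def blinfun_compose_ring e_mult e_mult_left)
    show "?q \<cdot> T \<cdot> ?q - t \<odot> ?q \<in> \<B>"
      using T by (auto intro!: B_diff B_compose B_scl)
    fix A
    assume A: "A \<in> \<A>" "corner (\<not> False) False A"
    have "?p \<cdot> A - A \<cdot> ?p = A"
      using A(2) by (simp add: corner_left corner_right)
    then have "L A = T \<cdot> A - A \<cdot> T + (?p \<cdot> L A - L A \<cdot> ?p)"
      using lie[OF e_mem[of True] A(1)] by (simp add: T_def)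
    then have "?p \<cdot> L A \<cdot> ?q = ?p \<cdot> (T \<cdot> A - A \<cdot> T + (?p \<cdot> L A - L A \<cdot> ?p)) \<cdot> ?q"
      by simp
    then have "?p \<cdot> T \<cdot> A = A \<cdot> T \<cdot> ?q"
      using A(2) by (simp add: blinfun_compose_ring e_mult e_mult_left corner_right corner_left')
    moreover have "?p \<cdot> T \<cdot> A = t \<odot> A"
      using A(2) tp pT by (simp add: corner_left)
    moreover have "A \<cdot> (?q \<cdot> T \<cdot> ?q) = A \<cdot> T \<cdot> ?q"
      using A(2) by (simp add: blinfun_compose_assoc corner_right')
    ultimately show "A \<cdot> (?q \<cdot> T \<cdot> ?q - t \<odot> ?q) = 0"
      using A by (simp add: blinfun_compose_diff_right A_B corner_right)
  qed simp
  have Tt: "L ?p = t \<odot> id_blinfun"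
    using p tp tq by (simp add: T_def op.scale_right_distrib flip: e_sum)
  \<comment> \<open>Brackets with the scalar operator \<open>L ?p\<close> vanish.\<close>
  have bracket_p: "L (?p \<cdot> A - A \<cdot> ?p) = ?p \<cdot> L A - L A \<cdot> ?p" if "A \<in> \<A>" for A
    using lie[OF e_mem[of True] that] that by (simp add: Tt A_B)
  have off_diagonal: "corner i j (L A)" if A: "A \<in> \<A>" "corner i j A" and ij: "i \<noteq> j" for i j A
  proof -
    \<comment> \<open>The bracket of p and \<open>A\<close> is \<open>A\<close> or
      \<open>- A\<close>; bracketing with \<open>e i\<close> instead absorbs the sign.\<close>
    have M: "L A = e i \<cdot> L A - L A \<cdot> e i"
    proof (cases i)
      case True
      then show ?thesis
        using bracket_p[OF A(1)] A(2) ij by (simp add: corner_left corner_right)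
    next
      case False
      then have "- L A = ?p \<cdot> L A - L A \<cdot> ?p"
        using bracket_p[OF A(1)] A ij
        by (simp add: corner_left corner_right additive_map_minus[OF L])
      moreover have "?p = id_blinfun - ?q"
        by (simp flip: e_sum)
      ultimately show ?thesis
        using False by (simp add: blinfun_compose_distrib algebra_simps)
    qed
    have *: "e k \<cdot> L A \<cdot> e l = e k \<cdot> (e i \<cdot> L A - L A \<cdot> e i) \<cdot> e l" for k l
      using M by simp
    have "e i \<cdot> L A \<cdot> e i = 0" "e j \<cdot> L A \<cdot> e j = 0" "e j \<cdot> L A \<cdot> e i = 0"
      using *[of i i] *[of j j] *[of j i] ij
      by (simp_all add: blinfun_compose_ring e_mult e_mult_left eq_neg_iff_add_eq_0 double_eq_0_iff)
    then show ?thesis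
      using corner_sum[of "L A"] ij by (cases i; cases j) (simp_all add: corner_def)
  qed
  have diagonal: "L A = ?p \<cdot> L A \<cdot> ?p + ?q \<cdot> L A \<cdot> ?q" if A: "A \<in> \<A>" "corner i i A" for i A
  proof -
    have "?p \<cdot> L A - L A \<cdot> ?p = 0"
      using bracket_p[OF A(1)] A(2) by (simp add: corner_left corner_right additive_map_zero[OF L])
    then have "?p \<cdot> (?p \<cdot> L A - L A \<cdot> ?p) \<cdot> ?q = 0" "?q \<cdot> (?p \<cdot> L A - L A \<cdot> ?p) \<cdot> ?p = 0"
      by simp_all
    then have "?p \<cdot> L A \<cdot> ?q = 0" "?q \<cdot> L A \<cdot> ?p = 0"
      by (simp_all add: blinfun_compose_ring e_mult e_mult_left)
    then show ?thesis
      using corner_sum[of "L A"] by simp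
  qed
  \<comment> \<open>The pair \<open>y\<close>, \<open>g\<close> reads the scalar off a multiple of
    \<open>?q\<close>, as \<open>x\<close> and \<open>f\<close> do for \<open>?p\<close>.\<close>
  obtain y where y: "blinfun_apply ?q y \<noteq> 0"
    using q by (metis blinfun_eqI zero_blinfun.rep_eq)
  then obtain g where g: "functional g" "g (blinfun_apply ?q y) = 1"
    by (rule ex_functional)
  \<comment> \<open>Each summand takes one diagonal corner of \<open>A\<close> and reads its image
    in the opposite corner. One summand vanishes if \<open>A\<close> lies in a diagonal corner, both
    if it lies in an off-diagonal one.\<close>
  define h where "h A = g (blinfun_apply (?q \<cdot> L (?p \<cdot> A \<cdot> ?p) \<cdot> ?q) y) +
    f (blinfun_apply (?p \<cdot> L (?q \<cdot> A \<cdot> ?q) \<cdot> ?p) x)" for A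
  have h_add: "h (A + B) = h A + h B" if "A \<in> \<A>" "B \<in> \<A>" for A B
  proof -
    note add = linear_add[OF bounded_linear.linear[OF functional_bounded_linear]]
    have "L (e i \<cdot> (A + B) \<cdot> e i) = L (e i \<cdot> A \<cdot> e i) + L (e i \<cdot> B \<cdot> e i)" for i
      using that by (simp add: blinfun_compose_distrib additive_map_add[OF L] A_compose)
    then show ?thesis
      unfolding h_def by (simp add: blinfun_compose_distrib blinfun.add_left blinfun.add_right add g(1) f)
  qed
  have h_True: "?q \<cdot> L A \<cdot> ?q = h A \<odot> ?q" if A: "A \<in> \<A>" "corner True True A" for A
  proof (rule blinfun_eqI)
    let ?N = "?q \<cdot> L A \<cdot> ?q"
    fix u
    \<comment> \<open>Products of \<open>A\<close> with an operator \<open>B\<close> of the other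
      diagonal corner vanish, so the Lie identity makes \<open>?N\<close> commute with
      \<open>B\<close>. Evaluation at \<open>y\<close> then shows that \<open>?N\<close> acts as a
      multiple of \<open>?q\<close>.\<close>
    define B where "B = ?q \<cdot> rank_one u g \<cdot> ?q"
    have B: "B \<in> \<A>" "corner False False B"
      unfolding B_def using g by (auto intro!: A_compose)
    have AB: "A \<cdot> B = 0" "B \<cdot> A = 0"
      using A B by (auto intro: corner_zero)
    then have "L A \<cdot> B - B \<cdot> L A + (A \<cdot> L B - L B \<cdot> A) = 0"
      using lie[OF A(1) B(1)] by (simp add: additive_map_zero[OF L])
    then have "?q \<cdot> (L A \<cdot> B - B \<cdot> L A + (A \<cdot> L B - L B \<cdot> A)) \<cdot> ?q = 0"
      by simp
    then have "?N \<cdot> B = B \<cdot> ?N"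
      using A B
      by (simp add: blinfun_compose_ring corner_left corner_right corner_left' corner_right')
    then have "blinfun_apply (?N \<cdot> B) y = blinfun_apply (B \<cdot> ?N) y"
      by simp
    moreover have "blinfun_apply (?N \<cdot> B) y = blinfun_apply ?N u"
    proof -
      have "?N \<cdot> B = ?N \<cdot> rank_one u g \<cdot> ?q"
        by (simp add: B_def blinfun_compose_assoc e_mult_left)
      then show ?thesis
        by (simp add: rank_one_apply g)
    qed
    moreover have "blinfun_apply (B \<cdot> ?N) y = smul (g (blinfun_apply ?N y)) (blinfun_apply ?q u)"
    proof -
      have "B \<cdot> ?N = ?q \<cdot> rank_one u g \<cdot> ?N"
        by (simp add: B_def blinfun_compose_assoc e_mult_left)
      then show ?thesis
        by (simp add: rank_one_apply g B_scale)
    qed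
    moreover have "h A = g (blinfun_apply ?N y)"
      using A by (simp add: h_def corner_def corner_left additive_map_zero[OF L] functional_zero[OF f])
    ultimately show "blinfun_apply ?N u = blinfun_apply (h A \<odot> ?q) u"
      by (simp add: op_scale_apply)
  qed
  have h_False: "?p \<cdot> L A \<cdot> ?p = h A \<odot> ?p" if A: "A \<in> \<A>" "corner False False A" for A
  proof -
    have h: "h A = f (blinfun_apply (?p \<cdot> L A \<cdot> ?p) x)"
      using A(2) corner_left[OF A(2), of True]
      by (simp add: h_def corner_def additive_map_zero[OF L] functional_zero[OF g(1)])
    show ?thesis
      unfolding h
      by (intro corner_True_eq corner_cut B_compose e_mem_B additive_map_mem[OF L] A(1))
  qed
  have h_off: "h A = 0" if "corner i j A" "i \<noteq> j" for i j A
  proof -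
    have "e k \<cdot> A \<cdot> e k = 0" for k
      using that by (simp add: blinfun_compose_assoc corner_left corner_right)
    then show ?thesis
      by (simp add: h_def additive_map_zero[OF L] functional_zero f g(1))
  qed
  define D where "D A = L A - h A \<odot> id_blinfun" for A
  have LD: "L A = D A + h A \<odot> id_blinfun" for A
    by (simp add: D_def)
  have D: "additive_map D"
  proof (rule additive_mapI)
    have "id_blinfun \<in> \<B>"
      using id_mem by auto
    then show "D A \<in> \<B>" if "A \<in> \<A>" for A
      unfolding D_def by (intro B_diff B_scl additive_map_mem[OF L] that)
    show "D (A + B) = D A + D B" if "A \<in> \<A>" "B \<in> \<A>" for A B
      using that by (simp add: D_def h_add additive_map_add[OF L] op.scale_left_distrib)
  qed
  \<comment> \<open>On the diagonal, subtracting \<open>h A\<close> cancels the part of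
    \<open>L A\<close> in the foreign corner and only shifts the part in the corner of
    \<open>A\<close>.\<close>
  have pres: "corner i j (D A)" if A: "A \<in> \<A>" "corner i j A" for i j A
  proof (cases "i = j")
    case False
    then show ?thesis
      using off_diagonal[OF A False] h_off[OF A(2) False] by (simp add: D_def)
  next
    case True
    have id: "h A \<odot> id_blinfun = h A \<odot> ?p + h A \<odot> ?q"
      by (simp flip: e_sum op.scale_right_distrib)
    show ?thesis
    proof (cases i)
      case True
      then have "L A - h A \<odot> ?q = ?p \<cdot> L A \<cdot> ?p"
        using diagonal[OF A(1), of i] h_True[OF A(1)] A(2) \<open>i = j\<close> by (simp only: diff_eq_eq)
      then have "D A = ?p \<cdot> L A \<cdot> ?p - h A \<odot> ?p"
        unfolding D_def id by (metis diff_diff_add add.commute)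
      then show ?thesis
        using True \<open>i = j\<close> by (simp add: corner_def blinfun_compose_ring e_mult e_mult_left)
    next
      case False
      then have "L A - h A \<odot> ?p = ?q \<cdot> L A \<cdot> ?q"
        using diagonal[OF A(1), of i] h_False[OF A(1)] A(2) \<open>i = j\<close> by (simp only: diff_eq_eq add.commute)
      then have "D A = ?q \<cdot> L A \<cdot> ?q - h A \<odot> ?q"
        unfolding D_def id by (metis diff_diff_add)
      then show ?thesis
        using False \<open>i = j\<close> by (simp add: corner_def blinfun_compose_ring e_mult e_mult_left)
    qed
  qed
  have lieD: "D (A \<cdot> B - B \<cdot> A) + h (A \<cdot> B - B \<cdot> A) \<odot> id_blinfun =
      D A \<cdot> B - B \<cdot> D A + (A \<cdot> D B - D B \<cdot> A)" if "A \<in> \<A>" "B \<in> \<A>" for A B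
    using lie[OF that] that by (simp add: LD blinfun_compose_distrib A_B)
  \<comment> \<open>The reversed products vanish, and so does \<open>h\<close> on the product, so
    the Lie identity reduces to the product rule.\<close>
  have mult_off: "D (A \<cdot> B) = D A \<cdot> B + A \<cdot> D B"
    if A: "A \<in> \<A>" "corner i j A" and B: "B \<in> \<A>" "corner j k B" and ik: "i \<noteq> k" for i j k A B
  proof -
    have "B \<cdot> A = 0" "D B \<cdot> A = 0" "B \<cdot> D A = 0"
      using A B pres[OF A] pres[OF B] ik by (auto intro: corner_zero)
    then show ?thesis
      using lieD[OF A(1) B(1)] h_off[OF corner_compose[OF A(2) B(2)] ik] by simp
  qed
  have "derivation D"
  proof (rule peirce_derivation[OF D pres])
    fix i j k A B
    assume A: "A \<in> \<A>" "corner i j A" and B: "B \<in> \<A>" "corner j k B" and ijk: "i \<or> j \<or> k"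
    have DA: "corner i j (D A)" and DB: "corner j k (D B)"
      using pres A B by auto
    consider "i \<noteq> k" | "i = k" "j \<noteq> i" | "i" "j" "k"
      using ijk by blast
    then show "D (A \<cdot> B) = D A \<cdot> B + A \<cdot> D B"
    proof cases
      case 1
      then show ?thesis using mult_off A B by blast
    next
      case 3
      show ?thesis
      proof (rule diagonal_mult[OF D pres, of True])
        show "D (A \<cdot> B) = D A \<cdot> B + A \<cdot> D B"
          if "A \<in> \<A>" "B \<in> \<A>" "corner (\<not> True) True A" "corner True True B" for A B
          using that by (intro mult_off) auto
      qed (use A B 3 q in auto)
    next
      case 2
      \<comment> \<open>\<open>c\<close> measures the defect: the rule fails by
        \<open>c \<odot> e i\<close> for \<open>A \<cdot> B\<close> and by the opposite multiple of
        \<open>e j\<close> for \<open>B \<cdot> A\<close>. Computing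
        \<open>D (A \<cdot> B \<cdot> A)\<close> along both bracketings gives
        \<open>c \<odot> A + c \<odot> A = 0\<close>.\<close>
      define c where "c = h (A \<cdot> B - B \<cdot> A)"
      have AB: "A \<cdot> B \<in> \<A>" "B \<cdot> A \<in> \<A>"
        using A B by auto
      have corners: "corner i i (A \<cdot> B)" "corner j j (B \<cdot> A)"
          "corner i i (D A \<cdot> B)" "corner i i (A \<cdot> D B)" "corner j j (D B \<cdot> A)" "corner j j (B \<cdot> D A)"
        using A B DA DB 2 by (auto intro: corner_compose)
      note Dcorners = pres[OF AB(1) corners(1)] pres[OF AB(2) corners(2)]
      have eq: "D (A \<cdot> B) - D (B \<cdot> A) + c \<odot> id_blinfun = D A \<cdot> B - B \<cdot> D A + (A \<cdot> D B - D B \<cdot> A)"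
        using lieD[OF A(1) B(1)] AB by (simp add: c_def additive_map_diff[OF D])
      then have "e k \<cdot> (D (A \<cdot> B) - D (B \<cdot> A) + c \<odot> id_blinfun) =
          e k \<cdot> (D A \<cdot> B - B \<cdot> D A + (A \<cdot> D B - D B \<cdot> A))" for k
        by simp
      from this[of i] this[of j]
      have i: "D (A \<cdot> B) + c \<odot> e i = D A \<cdot> B + A \<cdot> D B"
        and j: "D (B \<cdot> A) - c \<odot> e j = B \<cdot> D A + D B \<cdot> A"
        using corners Dcorners 2
        by (simp_all add: blinfun_compose_distrib corner_left algebra_simps)
      have "D (A \<cdot> B \<cdot> A) = D (A \<cdot> B) \<cdot> A + A \<cdot> B \<cdot> D A"
        using mult_off[OF AB(1) corners(1) A] 2 by simp
      moreover have "D (A \<cdot> (B \<cdot> A)) = D A \<cdot> (B \<cdot> A) + A \<cdot> D (B \<cdot> A)"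
        using mult_off[OF A AB(2) corners(2)] 2 by simp
      moreover have "D (A \<cdot> B) = D A \<cdot> B + A \<cdot> D B - c \<odot> e i"
        and "D (B \<cdot> A) = B \<cdot> D A + D B \<cdot> A + c \<odot> e j"
        using i j by (simp_all add: algebra_simps)
      ultimately have "(D A \<cdot> B + A \<cdot> D B - c \<odot> e i) \<cdot> A + A \<cdot> B \<cdot> D A =
          D A \<cdot> (B \<cdot> A) + A \<cdot> (B \<cdot> D A + D B \<cdot> A + c \<odot> e j)"
        by (simp add: blinfun_compose_assoc)
      then have "c \<odot> A + c \<odot> A = 0"
        using A 2 by (simp add: blinfun_compose_ring A_B corner_left corner_right algebra_simps)
      then have "c \<odot> A = 0"
        by (simp only: double_eq_0_iff)
      then consider "c = 0" | "A = 0" by auto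
      then show ?thesis
        using i by cases (simp_all add: additive_map_zero[OF D])
    qed
  qed
  moreover have "additive_on \<A> h"
    by (simp add: additive_on_def h_add)
  \<comment> \<open>A derivation satisfies the Lie identity without correction, so the scalar
    correction in \<open>lieD\<close> must be zero.\<close>
  moreover have "h (A \<cdot> B - B \<cdot> A) = 0" if AB: "A \<in> \<A>" "B \<in> \<A>" for A B
  proof -
    have "D (A \<cdot> B - B \<cdot> A) = D A \<cdot> B - B \<cdot> D A + (A \<cdot> D B - D B \<cdot> A)"
      using AB additive_map_diff[OF D, of "A \<cdot> B" "B \<cdot> A"] \<open>derivation D\<close>
      by (simp add: derivation_mult A_compose)
    then have "h (A \<cdot> B - B \<cdot> A) \<odot> id_blinfun = 0"
      using lieD[OF AB] by simp
    moreover have "id_blinfun \<noteq> (0 :: 'x \<Rightarrow>\<^sub>L 'x)"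
      using x_nonzero by (metis blinfun_apply_id_blinfun zero_blinfun.rep_eq)
    ultimately show ?thesis by simp
  qed
  ultimately show thesis
    using LD by (rule that)
qed

text \<open>An inner derivation makes the value at p diagonal. Taking it off again changes
  \<open>D\<close> by a derivation and leaves \<open>h\<close> as it is.\<close>

lemma Lie_derivation:
  assumes L: "additive_map L"
    and lie: "\<And>A B. A \<in> \<A> \<Longrightarrow> B \<in> \<A> \<Longrightarrow>
      L (A \<cdot> B - B \<cdot> A) = L A \<cdot> B - B \<cdot> L A + (A \<cdot> L B - L B \<cdot> A)"
    and q: "e False \<noteq> 0"
  obtains D h where "derivation D" "additive_on \<A> h"
    "\<And>A B. A \<in> \<A> \<Longrightarrow> B \<in> \<A> \<Longrightarrow> h (A \<cdot> B - B \<cdot> A) = 0"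
    "\<And>A. A \<in> \<A> \<Longrightarrow> L A = D A + h A \<odot> id_blinfun"
proof -
  define T where "T = L (e True)"
  define S where "S = e False \<cdot> T \<cdot> e True - e True \<cdot> T \<cdot> e False"
  have S: "S \<in> \<B>"
    unfolding S_def T_def by (intro B_diff B_compose e_mem_B additive_map_mem[OF L] e_mem)
  let ?E = "\<lambda>A. L A + (A \<cdot> S - S \<cdot> A)"
  have Ep: "?E (e True) = e True \<cdot> T \<cdot> e True + e False \<cdot> T \<cdot> e False"
    using inner_off_diagonal[of T] by (simp add: S_def T_def)
  obtain D h where Dh: "derivation D" "additive_on \<A> h"
    "\<And>A B. A \<in> \<A> \<Longrightarrow> B \<in> \<A> \<Longrightarrow> h (A \<cdot> B - B \<cdot> A) = 0"
    "\<And>A. A \<in> \<A> \<Longrightarrow> ?E A = D A + h A \<odot> id_blinfun"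
  proof (rule Lie_derivation_normalized[of ?E])
    show "additive_map ?E"
      using L derivation_additive[OF derivation_inner[OF S]] by (rule additive_map_plus)
    show "?E (A \<cdot> B - B \<cdot> A) = ?E A \<cdot> B - B \<cdot> ?E A + (A \<cdot> ?E B - ?E B \<cdot> A)"
      if "A \<in> \<A>" "B \<in> \<A>" for A B
      using that by (simp add: lie blinfun_compose_ring algebra_simps)
    show "?E (e True) = e True \<cdot> ?E (e True) \<cdot> e True + e False \<cdot> ?E (e True) \<cdot> e False"
      unfolding Ep by (simp add: blinfun_compose_ring e_mult e_mult_left)
  qed (use q in auto)
  have "derivation (\<lambda>A. D A + (A \<cdot> (- S) - (- S) \<cdot> A))"
    using Dh(1) derivation_inner[OF B_minus[OF S]] by (rule derivation_plus)
  moreover have "L A = D A + (A \<cdot> (- S) - (- S) \<cdot> A) + h A \<odot> id_blinfun" if "A \<in> \<A>" for A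
    using Dh(4)[OF that] by (simp add: blinfun_compose_distrib algebra_simps)
  ultimately show thesis
    using Dh(2,3) by (intro that)
qed

end

section \<open>Maps of \<open>\<xi>\<close>-Lie type\<close>

context standard_algebra
begin

lemma Jordan_derivation_is_derivation:
  assumes D: "additive_map D"
    and square: "\<And>A. A \<in> \<A> \<Longrightarrow> D (A \<cdot> A) = D A \<cdot> A + A \<cdot> D A"
  shows "derivation D"
proof (cases "\<exists>x::'x. x \<noteq> 0")
  case True
  then obtain x :: 'x where "x \<noteq> 0" by blast
  then obtain f where "functional f" "f x = 1"
    by (rule ex_functional)
  then interpret peirce smul \<A> x f
    by unfold_locales
  show ?thesis
    using assms by (rule Jordan_derivation)
next
  case False
  then have eq: "S = T" for S T :: "'x \<Rightarrow>\<^sub>L 'x"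
    by (intro blinfun_eqI) metis
  show ?thesis
    by (rule derivationI[OF D]) (rule eq)
qed

lemma xi_commutator_eq: "xi_commutator smul \<xi> A B = A \<cdot> B - \<xi> \<odot> (B \<cdot> A)"
  by (simp add: xi_commutator_def)

text \<open>Both pairs compute \<phi> at the same operator, and subtraction leaves the factor 1 +
  \<xi>. For \<xi> = -1 the two identities coincide, but each then evaluates \<phi> at
  \<open>A + A\<close>, where additivity is enough.\<close>

lemma left_xi_centralizer:
  assumes P: "additive_map \<phi>"
    and xi: "\<And>A B. A \<in> \<A> \<Longrightarrow> B \<in> \<A> \<Longrightarrow> \<phi> (A \<cdot> B - \<xi> \<odot> (B \<cdot> A)) = \<phi> A \<cdot> B - \<xi> \<odot> (\<phi> B \<cdot> A)"
    and A: "A \<in> \<A>"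
  shows "\<phi> A = \<phi> id_blinfun \<cdot> A"
proof (cases "\<xi> = - 1")
  case True
  then have "\<phi> A + \<phi> A = \<phi> id_blinfun \<cdot> A + \<phi> A"
    using xi[OF id_mem A] A by (simp add: scl_minus_one additive_map_add[OF P])
  then show ?thesis by simp
next
  case False
  have "\<phi> id_blinfun \<cdot> A - \<xi> \<odot> \<phi> A = \<phi> A - \<xi> \<odot> (\<phi> id_blinfun \<cdot> A)"
    using xi[OF id_mem A] xi[OF A id_mem] by simp
  then have "(1 + \<xi>) \<odot> (\<phi> id_blinfun \<cdot> A - \<phi> A) = 0"
    by (simp add: op.scale_left_distrib op.scale_right_diff_distrib algebra_simps)
  then have "\<phi> id_blinfun \<cdot> A - \<phi> A = 0"
    using False by (metis add.commute add_eq_0_iff op.scale_eq_0_iff)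
  then show ?thesis by simp
qed

text \<open>\<open>L\<close> is merely additive, so the factor 1 - \<xi> cannot be pulled out of it.
  Instead, the identities for \<open>A\<close> with itself and for the identity with
  \<open>A \<cdot> A\<close> evaluate \<open>L\<close> at the same multiple of the square, and
  \<open>c\<close> is the scalar of \<open>L id_blinfun\<close>. For \<xi> = -1 that multiple is
  \<open>A \<cdot> A + A \<cdot> A\<close>, and \<open>c = 0\<close> works.\<close>

lemma xi_Lie_derivation_square:
  assumes L: "additive_map L"
    and lie: "\<And>A B. A \<in> \<A> \<Longrightarrow> B \<in> \<A> \<Longrightarrow> L (A \<cdot> B - \<xi> \<odot> (B \<cdot> A)) =
      L A \<cdot> B - \<xi> \<odot> (B \<cdot> L A) + (A \<cdot> L B - \<xi> \<odot> (L B \<cdot> A))"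
    and \<xi>: "\<xi> \<noteq> 1"
  obtains c where "\<And>A. A \<in> \<A> \<Longrightarrow> L (A \<cdot> A) = L A \<cdot> A + A \<cdot> L A - c \<odot> (A \<cdot> A)"
proof (cases "\<xi> = - 1")
  case True
  show thesis
  proof (rule that[of 0])
    fix A
    assume A: "A \<in> \<A>"
    then have "L (A \<cdot> A) + L (A \<cdot> A) = (L A \<cdot> A + A \<cdot> L A) + (L A \<cdot> A + A \<cdot> L A)"
      using lie[OF A A] True
      by (simp add: scl_minus_one additive_map_add[OF L] A_compose algebra_simps)
    then show "L (A \<cdot> A) = L A \<cdot> A + A \<cdot> L A - 0 \<odot> (A \<cdot> A)"
      by (simp flip: scaleR_2)
  qed
next
  case False
  let ?M = "L id_blinfun"
  have "?M \<cdot> A = A \<cdot> ?M" if A: "A \<in> \<A>" for A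
  proof -
    have "L A - \<xi> \<odot> L A + (A \<cdot> ?M - \<xi> \<odot> (?M \<cdot> A)) = ?M \<cdot> A - \<xi> \<odot> (A \<cdot> ?M) + (L A - \<xi> \<odot> L A)"
      using lie[OF id_mem A] lie[OF A id_mem] by simp
    then have "(1 + \<xi>) \<odot> (?M \<cdot> A - A \<cdot> ?M) = 0"
      by (simp add: op.scale_left_distrib op.scale_right_diff_distrib algebra_simps)
    then have "?M \<cdot> A - A \<cdot> ?M = 0"
      using False by (metis add.commute add_eq_0_iff op.scale_eq_0_iff)
    then show ?thesis by simp
  qed
  then obtain c where c: "?M = c \<odot> id_blinfun"
    by (rule commutant_scalar[OF additive_map_mem[OF L id_mem]])
  show thesis
  proof (rule that)
    fix A
    assume A: "A \<in> \<A>"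
    have "L ((1 - \<xi>) \<odot> (A \<cdot> A)) = (1 - \<xi>) \<odot> (L A \<cdot> A + A \<cdot> L A)"
      using lie[OF A A]
      by (simp add: op.scale_left_diff_distrib op.scale_right_distrib algebra_simps)
    moreover have "L ((1 - \<xi>) \<odot> (A \<cdot> A)) = (1 - \<xi>) \<odot> (L (A \<cdot> A) + c \<odot> (A \<cdot> A))"
      using lie[OF id_mem A_compose[OF A A]] A
      by (simp add: c A_B B_compose op.scale_left_diff_distrib op.scale_right_distrib algebra_simps)
    ultimately have "L A \<cdot> A + A \<cdot> L A = L (A \<cdot> A) + c \<odot> (A \<cdot> A)"
      using \<xi> by (metis op.scale_cancel_left right_minus_eq)
    then show "L (A \<cdot> A) = L A \<cdot> A + A \<cdot> L A - c \<odot> (A \<cdot> A)"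
      by simp
  qed
qed

text \<open>Subtracting \<open>c \<odot> A\<close> turns the modified square identity into the
  Jordan one. Pairing \<open>A\<close> with the identity gives \<open>D (\<xi> \<odot> A)\<close>,
  and inserting this into the identity for a general pair leaves the commutation relation.\<close>

lemma xi_Lie_derivation_structure:
  assumes L: "additive_map L"
    and lie: "\<And>A B. A \<in> \<A> \<Longrightarrow> B \<in> \<A> \<Longrightarrow> L (A \<cdot> B - \<xi> \<odot> (B \<cdot> A)) =
      L A \<cdot> B - \<xi> \<odot> (B \<cdot> L A) + (A \<cdot> L B - \<xi> \<odot> (L B \<cdot> A))"
    and \<xi>: "\<xi> \<noteq> 1"
  obtains D c where "derivation D" "\<And>A. A \<in> \<A> \<Longrightarrow> L A = D A + c \<odot> A"
    "\<And>A. A \<in> \<A> \<Longrightarrow> D (\<xi> \<odot> A) = \<xi> \<odot> D A - (c * (1 - \<xi>)) \<odot> A"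
    "\<And>A B. A \<in> \<A> \<Longrightarrow> B \<in> \<A> \<Longrightarrow> c \<odot> (A \<cdot> B) = c \<odot> (B \<cdot> A)"
proof -
  obtain c where c: "\<And>A. A \<in> \<A> \<Longrightarrow> L (A \<cdot> A) = L A \<cdot> A + A \<cdot> L A - c \<odot> (A \<cdot> A)"
    using xi_Lie_derivation_square[OF assms] by blast
  define D where "D A = L A - c \<odot> A" for A
  have LD: "L A = D A + c \<odot> A" for A
    by (simp add: D_def)
  have add: "additive_map D"
    by (intro additive_mapI)
      (auto simp: D_def additive_map_add[OF L] op.scale_right_distrib intro!: B_diff B_scl additive_map_mem[OF L])
  have D: "derivation D"
  proof (rule Jordan_derivation_is_derivation[OF add])
    show "D (A \<cdot> A) = D A \<cdot> A + A \<cdot> D A" if "A \<in> \<A>" for A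
      using that by (simp add: D_def c blinfun_compose_distrib A_B)
  qed
  have D_id: "D id_blinfun = 0"
    using derivation_mult[OF D id_mem id_mem] by simp
  have D_xi: "D (\<xi> \<odot> A) = \<xi> \<odot> D A - (c * (1 - \<xi>)) \<odot> A" if A: "A \<in> \<A>" for A
    using lie[OF id_mem A] A
    by (simp add: LD D_id A_scl A_B additive_map_diff[OF add] op.scale_right_distrib
        op.scale_right_diff_distrib op.scale_left_diff_distrib algebra_simps)
  have "c \<odot> (A \<cdot> B) = c \<odot> (B \<cdot> A)" if A: "A \<in> \<A>" and B: "B \<in> \<A>" for A B
    using lie[OF A B] A B D_xi[OF A_compose[OF B A]]
    by (auto simp: LD A_scl A_B A_compose additive_map_diff[OF add] derivation_mult[OF D]
        blinfun_compose_distrib op.scale_right_distrib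
        op.scale_right_diff_distrib op.scale_left_diff_distrib algebra_simps)
  with D LD D_xi show thesis
    by (rule that)
qed

text \<open>Left multiplication by \<open>K\<close> contributes \<open>K \<cdot> A \<cdot> B\<close>
  to both sides, so \<open>D\<close> serves as the associated derivation.\<close>

lemma generalized_derivationI:
  assumes D: "derivation D" and K: "K \<in> \<B>"
    and T: "\<And>A. A \<in> \<A> \<Longrightarrow> \<tau> A = K \<cdot> A + D A"
  shows "additive_generalized_derivation smul \<A> \<tau>"
proof -
  note add = derivation_additive[OF D]
  have "additive_map \<tau>"
    using K by (intro additive_mapI)
      (auto simp: T A_add blinfun_compose_distrib additive_map_add[OF add]
        intro!: B_add B_compose additive_map_mem[OF add])
  moreover have "\<tau> (A \<cdot> B) = \<tau> A \<cdot> B + A \<cdot> D B" if "A \<in> \<A>" "B \<in> \<A>" for A B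
    using that by (simp add: T A_compose derivation_mult[OF D] blinfun_compose_ring add.assoc)
  ultimately show ?thesis
    using D unfolding additive_generalized_derivation_def additive_map_def derivation_def by blast
qed

text \<open>A nonzero \<open>c\<close> would make \<A> commutative, hence the space a line. On a
  line the relation says nothing, and \<open>c\<close> can survive together with an additive
  derivation of the field that does not vanish at \<xi>.\<close>

lemma commutative_scalar_zero:
  assumes comm: "\<And>A B. A \<in> \<A> \<Longrightarrow> B \<in> \<A> \<Longrightarrow> c \<odot> (A \<cdot> B) = c \<odot> (B \<cdot> A)"
    and dim: "vector_space.dim smul UNIV \<noteq> 1" and x: "(x::'x) \<noteq> 0"
  shows "c = 0"
proof (rule ccontr)
  assume "c \<noteq> 0"
  then have AB: "A \<cdot> B = B \<cdot> A" if "A \<in> \<A>" "B \<in> \<A>" for A B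
    using comm[OF that] by simp
  have "vector_space.dim smul UNIV = 1"
    by (rule dim_eq_1_if_rank_one_commute[OF x]) (auto intro!: AB)
  with dim show False by contradiction
qed

text \<open>If \<open>e False\<close> were zero, p would be the identity and every vector a multiple
  of \<open>x\<close>, against the independence of \<open>x\<close> and \<open>y\<close>.\<close>

lemma ex_peirce:
  assumes "dim_at_least smul 3"
  obtains x f where "peirce smul \<A> x f" "peirce.e smul x f False \<noteq> 0"
proof -
  obtain S where S: "finite S" "card S = 3" "\<not> dependent S"
    using assms unfolding dim_at_least_def by blast
  then obtain x y where xy: "x \<in> S" "y \<in> S" "x \<noteq> y"
    by (metis card_3_iff insertI1 insert_subset subset_insertI)
  have "x \<noteq> 0"
    using S xy dependent_zero by blast
  then obtain f where f: "functional f" "f x = 1"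
    by (rule ex_functional)
  then interpret peirce smul \<A> x f
    by unfold_locales
  have "e False \<noteq> 0"
  proof
    assume "e False = 0"
    then have "blinfun_apply (e True) y = y"
      using e_sum by simp
    then have "y = smul (f y) x"
      by (simp add: e_True_apply)
    moreover have "smul (f y) x \<in> span (S - {y})"
      using xy by (intro span_scale span_base) auto
    ultimately have "y \<in> span (S - {y})" by simp
    then have "dependent S"
      using xy unfolding dependent_def by blast
    with S show False by blast
  qed
  with peirce_axioms show thesis by (rule that)
qed

end

theorem theorem3p3:
  fixes smul :: "'f::real_or_complex \<Rightarrow> 'x::banach \<Rightarrow> 'x"
    and \<A> :: "('x \<Rightarrow>\<^sub>L 'x) set"
    and \<xi> :: 'f
    and \<delta> :: "('x \<Rightarrow>\<^sub>L 'x) \<Rightarrow> ('x \<Rightarrow>\<^sub>L 'x)"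
  assumes "banach_space_over smul"
    and "standard_operator_algebra smul \<A>"
    and "id_blinfun \<in> \<A>"
    and "\<xi> \<noteq> 0"
    and "additive_generalized_xi_Lie_derivation smul \<xi> \<A> \<delta>"
  shows "(\<xi> = 1 \<and> dim_at_least smul 3 \<longrightarrow>
      (\<exists>\<tau> (h :: ('x \<Rightarrow>\<^sub>L 'x) \<Rightarrow> 'f).
        additive_generalized_derivation smul \<A> \<tau> \<and>
        additive_on \<A> h \<and>
        (\<forall>A\<in>\<A>. \<forall>B\<in>\<A>. h (commutator A B) = 0) \<and>
        (\<forall>A\<in>\<A>. \<delta> A = \<tau> A + op_scale smul (h A) id_blinfun)))
    \<and> (\<xi> \<noteq> 1 \<longrightarrow>
        additive_generalized_derivation smul \<A> \<delta> \<and>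
        (vector_space.dim smul UNIV \<noteq> 1 \<longrightarrow>
          (\<forall>A\<in>\<A>. \<delta> (op_scale smul \<xi> A) = op_scale smul \<xi> (\<delta> A))))"
proof -
  interpret banach_space_over smul by fact
  interpret standard_algebra smul \<A>
    using assms(2,3) by unfold_locales
  obtain L where \<delta>: "additive_map \<delta>" and L: "additive_map L"
    and lie: "\<And>A B. A \<in> \<A> \<Longrightarrow> B \<in> \<A> \<Longrightarrow> L (A \<cdot> B - \<xi> \<odot> (B \<cdot> A)) =
      L A \<cdot> B - \<xi> \<odot> (B \<cdot> L A) + (A \<cdot> L B - \<xi> \<odot> (L B \<cdot> A))"
    and gen: "\<And>A B. A \<in> \<A> \<Longrightarrow> B \<in> \<A> \<Longrightarrow> \<delta> (A \<cdot> B - \<xi> \<odot> (B \<cdot> A)) =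
      \<delta> A \<cdot> B - \<xi> \<odot> (\<delta> B \<cdot> A) + A \<cdot> L B - \<xi> \<odot> (B \<cdot> L A)"
    using assms(5)
    unfolding additive_generalized_xi_Lie_derivation_def additive_xi_Lie_derivation_def
      additive_map_def xi_commutator_eq by blast
  define \<phi> where "\<phi> A = \<delta> A - L A" for A
  have \<phi>: "additive_map \<phi>"
    by (intro additive_mapI)
      (auto simp: \<phi>_def additive_map_add[OF L] additive_map_add[OF \<delta>]
        intro!: B_diff additive_map_mem[OF L] additive_map_mem[OF \<delta>])
  define K where "K = \<phi> id_blinfun"
  have K: "K \<in> \<B>"
    unfolding K_def by (rule additive_map_mem[OF \<phi> id_mem])
  have "\<phi> A = K \<cdot> A" if "A \<in> \<A>" for A
    unfolding K_def
  proof (rule left_xi_centralizer[OF \<phi> _ that])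
    show "\<phi> (A \<cdot> B - \<xi> \<odot> (B \<cdot> A)) = \<phi> A \<cdot> B - \<xi> \<odot> (\<phi> B \<cdot> A)" if "A \<in> \<A>" "B \<in> \<A>" for A B
      using that
      by (simp add: \<phi>_def lie gen blinfun_compose_distrib op.scale_right_diff_distrib algebra_simps)
  qed
  then have \<delta>L: "\<delta> A = K \<cdot> A + L A" if "A \<in> \<A>" for A
    using that by (simp add: \<phi>_def algebra_simps)
  show ?thesis
  proof (intro conjI impI)
    assume "\<xi> = 1 \<and> dim_at_least smul 3"
    then have \<xi>: "\<xi> = 1" and dim: "dim_at_least smul 3" by auto
    obtain x f where xf: "peirce smul \<A> x f" "peirce.e smul x f False \<noteq> 0"
      by (rule ex_peirce[OF dim])
    obtain D h where D: "derivation D" and h: "additive_on \<A> h"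
      "\<And>A B. A \<in> \<A> \<Longrightarrow> B \<in> \<A> \<Longrightarrow> h (A \<cdot> B - B \<cdot> A) = 0"
      and LD: "\<And>A. A \<in> \<A> \<Longrightarrow> L A = D A + h A \<odot> id_blinfun"
      using peirce.Lie_derivation[OF xf(1) L lie[unfolded \<xi> op.scale_one] xf(2)] by blast
    have "additive_generalized_derivation smul \<A> (\<lambda>A. K \<cdot> A + D A)"
      using D K by (rule generalized_derivationI) simp
    then show "\<exists>\<tau> (h :: ('x \<Rightarrow>\<^sub>L 'x) \<Rightarrow> 'f).
        additive_generalized_derivation smul \<A> \<tau> \<and>
        additive_on \<A> h \<and>
        (\<forall>A\<in>\<A>. \<forall>B\<in>\<A>. h (commutator A B) = 0) \<and>
        (\<forall>A\<in>\<A>. \<delta> A = \<tau> A + op_scale smul (h A) id_blinfun)"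
      using h by (intro exI[of _ "\<lambda>A. K \<cdot> A + D A"] exI[of _ h])
        (simp add: \<delta>L LD commutator_def)
  next
    assume \<xi>: "\<xi> \<noteq> 1"
    obtain D c where D: "derivation D" and LD: "\<And>A. A \<in> \<A> \<Longrightarrow> L A = D A + c \<odot> A"
      and D\<xi>: "\<And>A. A \<in> \<A> \<Longrightarrow> D (\<xi> \<odot> A) = \<xi> \<odot> D A - (c * (1 - \<xi>)) \<odot> A"
      and c: "\<And>A B. A \<in> \<A> \<Longrightarrow> B \<in> \<A> \<Longrightarrow> c \<odot> (A \<cdot> B) = c \<odot> (B \<cdot> A)"
      using xi_Lie_derivation_structure[OF L lie \<xi>] by blast
    show "additive_generalized_derivation smul \<A> \<delta>"
    proof (rule generalized_derivationI[OF D])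
      \<comment> \<open>The scalar \<open>c\<close>, possibly nonzero when the space is a line,
        joins the left multiplier.\<close>
      show "K + c \<odot> id_blinfun \<in> \<B>"
        using K id_mem by auto
      show "\<delta> A = (K + c \<odot> id_blinfun) \<cdot> A + D A" if "A \<in> \<A>" for A
        using that by (simp add: \<delta>L LD blinfun_compose_distrib)
    qed
    show "\<forall>A\<in>\<A>. \<delta> (\<xi> \<odot> A) = \<xi> \<odot> \<delta> A" if dim: "vector_space.dim smul UNIV \<noteq> 1"
    proof (cases "\<exists>x::'x. x \<noteq> 0")
      case True
      then have "c = 0"
        using commutative_scalar_zero[OF c dim] by blast
      then show ?thesis
        using K by (simp add: \<delta>L LD D\<xi> A_scl op.scale_right_distrib)
    next
      \<comment> \<open>On the zero space all operators are equal.\<close>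
      case False
      then show ?thesis
        by (intro ballI blinfun_eqI) metis
    qed
  qed
qed

end
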